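(* For every positive integer $n$ there exists a reversible circuit $\mathcal{C}_n$ over the gate set $\{\text{Toffoli}, \mathsf{CNOT}, \mathsf{X}\}$ that implements the in-place addition operator $\mathsf{Add}_n$ using $n - \omega(n) - \lfloor \log n \rfloor$ ancilla qubits, where, as $n \to \infty$, the Toffoli-count of $\mathcal{C}_n$ is $8n - \Theta(\log n)$ and the Toffoli-depth of $\mathcal{C}_n$ is $4\log n + \Theta(1)$.
   Context: $\log$ denotes the binary logarithm and $\omega(n)$ denotes the Hamming weight of $n$, i.e. the number of ones in its binary expansion. The operator $\mathsf{Add}_n$ acts on $2n+1$ qubits: for $n$-bit integers $a, b \in \{0,\dots,2^n-1\}$ (each stored in binary in an $n$-qubit register) and $z\in\{0,1\}$, $$\mathsf{Add}_n : |a\rangle\,|b\rangle\,|z\rangle \longmapsto |a\rangle\,|a+b \bmod 2^n\rangle\,|z\oplus (a+b)_n\rangle,$$ where $(a+b)_n$ is the bit of weight $2^n$ in the binary expansion of $a+b$ (the final carry). Gates: $\mathsf{X}$ maps $|x\rangle\mapsto|x\oplus 1\rangle$; $\mathsf{CNOT}$ maps $|x\rangle|y\rangle\mapsto|x\rangle|y\oplus x\rangle$; the Toffoli gate maps $|x\rangle|y\rangle|t\rangle\mapsto|x\rangle|y\rangle|t\oplus xy\rangle$. Gates may be applied to arbitrary (distinct) qubits, with no connectivity restriction. A circuit implements $\mathsf{Add}_n$ with $k$ ancilla qubits if it acts on $2n+1+k$ qubits and, when the $k$ ancilla qubits are initialized to $|0\rangle$, it applies $\mathsf{Add}_n$ to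 the other $2n+1$ qubits and returns all ancilla qubits to $|0\rangle$ at the end. The Toffoli-count of a circuit is its number of Toffoli gates. The Toffoli-depth is the number of Toffoli layers, where a layer consists of Toffoli gates acting on pairwise disjoint sets of qubits and executed in parallel ($\mathsf{CNOT}$ and $\mathsf{X}$ gates are not counted). The additive term $\Theta(1)$ in the depth stands for a quantity that remains bounded as $n\to\infty$; $8n-\Theta(\log n)$ means $8n - f(n)$ with $f(n)=\Theta(\log n)$. *)

theory Defs
  imports Complex_Main "HOL-Library.Landau_Symbols"
begin

text \<open>A pure state of \<open>N\<close> qubits is given by its amplitudes in the computational basis, the basis
  states being the bit lists of length \<open>N\<close>; amplitudes of lists of other lengths are zero.
  Normalisation is not required, all operators being linear.\<close>

type_synonym state = "bool list \<Rightarrow> complex"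

definition states :: "nat \<Rightarrow> state set" where
  "states N = {\<psi>. \<forall>x. length x \<noteq> N \<longrightarrow> \<psi> x = 0}"

definition ket :: "bool list \<Rightarrow> state" where
  "ket x = (\<lambda>y. of_bool (y = x))"

text \<open>Tensor product of a state of \<open>N\<close> qubits with a state of further qubits.\<close>

definition tensor :: "nat \<Rightarrow> state \<Rightarrow> state \<Rightarrow> state" where
  "tensor N \<psi> \<phi> = (\<lambda>x. \<psi> (take N x) * \<phi> (drop N x))"

datatype gate = X nat | CNOT nat nat | is_Toffoli: Toffoli nat nat nat

fun wires :: "gate \<Rightarrow> nat list" where
  "wires (X t) = [t]"
| "wires (CNOT c t) = [c, t]"
| "wires (Toffoli c d t) = [c, d, t]"

definition valid_gate :: "nat \<Rightarrow> gate \<Rightarrow> bool" where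
  "valid_gate N g \<longleftrightarrow> distinct (wires g) \<and> set (wires g) \<subseteq> {..<N}"

text \<open>Disequality of Booleans is exclusive or.\<close>

fun gate_map :: "gate \<Rightarrow> bool list \<Rightarrow> bool list" where
  "gate_map (X t) x = x[t := \<not> x ! t]"
| "gate_map (CNOT c t) x = x[t := (x ! t \<noteq> x ! c)]"
| "gate_map (Toffoli c d t) x = x[t := (x ! t \<noteq> (x ! c \<and> x ! d))]"

definition gate_op :: "nat \<Rightarrow> gate \<Rightarrow> state \<Rightarrow> state" where
  "gate_op N g \<psi> = (\<lambda>y. \<Sum>x | length x = N. \<psi> x * ket (gate_map g x) y)"

text \<open>A circuit is a list of gates; its head is applied first.\<close>

definition circuit_op :: "nat \<Rightarrow> gate list \<Rightarrow> state \<Rightarrow> state" where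
  "circuit_op N gs = fold (gate_op N) gs"

text \<open>Registers are stored with the least significant bit first.\<close>

definition reg :: "nat \<Rightarrow> nat \<Rightarrow> bool list" where
  "reg n a = map (bit a) [0..<n]"

definition add_op :: "nat \<Rightarrow> state \<Rightarrow> state" where
  "add_op n \<psi> = (\<lambda>y. \<Sum>a<2^n. \<Sum>b<2^n. \<Sum>z\<in>UNIV.
     \<psi> (reg n a @ reg n b @ [z]) *
     ket (reg n a @ reg n ((a + b) mod 2^n) @ [z \<noteq> bit (a + b) n]) y)"

definition implements_add :: "nat \<Rightarrow> nat \<Rightarrow> gate list \<Rightarrow> bool" where
  "implements_add n k gs \<longleftrightarrow>
     (\<forall>g\<in>set gs. valid_gate (2*n + 1 + k) g) \<and>
     (\<forall>\<psi>\<in>states (2*n + 1).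
        circuit_op (2*n + 1 + k) gs (tensor (2*n + 1) \<psi> (ket (replicate k False)))
          = tensor (2*n + 1) (add_op n \<psi>) (ket (replicate k False)))"

definition toffoli_count :: "gate list \<Rightarrow> nat" where
  "toffoli_count gs = length (filter is_Toffoli gs)"

text \<open>A schedule of the gates into \<open>d\<close> Toffoli layers that respects the order of any two gates with a
  common qubit. A Toffoli gate \<open>gs ! i\<close> is executed in layer \<open>L i\<close>, one of \<open>1, \<dots>, d\<close>; any other gate
  is executed after the layer \<open>L i\<close> and before the next one (before the first layer if \<open>L i = 0\<close>).
  So a Toffoli gate must come strictly later than every earlier gate it shares a qubit with;
  in particular the Toffoli gates of one layer act on pairwise disjoint sets of qubits.\<close>

definition toffoli_layering :: "gate list \<Rightarrow> nat \<Rightarrow> (nat \<Rightarrow> nat) \<Rightarrow> bool" where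
  "toffoli_layering gs d L \<longleftrightarrow>
     (\<forall>i<length gs. L i \<le> d \<and> (is_Toffoli (gs ! i) \<longrightarrow> 1 \<le> L i)) \<and>
     (\<forall>j<length gs. \<forall>i<j. set (wires (gs ! i)) \<inter> set (wires (gs ! j)) \<noteq> {} \<longrightarrow>
        (if is_Toffoli (gs ! j) then L i < L j else L i \<le> L j))"

text \<open>The number of layers when gates are executed in parallel whenever possible. Putting every
  Toffoli gate in a layer of its own is always a layering, so the minimum is attained.\<close>

definition toffoli_depth :: "gate list \<Rightarrow> nat" where
  "toffoli_depth gs = (LEAST d. \<exists>L. toffoli_layering gs d L)"

definition hamming_weight :: "nat \<Rightarrow> nat" where
  "hamming_weight n = card {i. bit n i}"

end

theory Submission
  imports Defs "HOL-Library.Discrete_Functions"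
begin

text \<open>The carries obey \<open>c (i + 1) = a i \<oplus> (a i \<oplus> b i) \<cdot> (a i \<oplus> c i)\<close>. Hence in the ancilla-free
  ripple-carry adder of Takahashi, Tani and Kunihiro, which writes \<open>a i \<oplus> c i\<close> over \<open>a i\<close>, a ladder
  of Toffoli gates computes all carries in place, and a second ladder uncomputes them. A ladder is the
  prefix composition of affine maps \<open>x \<mapsto> g \<oplus> p \<cdot> x\<close>. Organised as a binary tree of the
  Brent-Kung kind, a ladder of \<open>n\<close> gates gets depth \<open>2 log n + O(1)\<close> with
  \<open>4 n - 3 \<omega>(n) - 3 \<lfloor>log n\<rfloor> - 1\<close> gates; ancillas are needed for the products of the \<open>p i\<close> only,
  and there are \<open>n - \<omega>(n) - \<lfloor>log n\<rfloor>\<close> of them. Conversely the depth is at least the number of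
  Toffoli gates that touch a fixed wire; the carry of index \<open>2 ^ s\<close> takes part in the first
  \<open>s\<close> levels of both sweeps of both ladders.\<close>

section \<open>Gates on bit assignments\<close>

text \<open>Assignments are total functions, so evaluating circuits needs no length or range
  conditions; \<open>map_run\<close> transfers the results to bit lists.\<close>

fun act :: "gate \<Rightarrow> (nat \<Rightarrow> bool) \<Rightarrow> nat \<Rightarrow> bool" where
  "act (X t) f = f(t := \<not> f t)"
| "act (CNOT c t) f = f(t := (f t \<noteq> f c))"
| "act (Toffoli c d t) f = f(t := (f t \<noteq> (f c \<and> f d)))"

abbreviation run :: "gate list \<Rightarrow> (nat \<Rightarrow> bool) \<Rightarrow> nat \<Rightarrow> bool" where
  "run gs \<equiv> fold act gs"

abbreviation target :: "gate \<Rightarrow> nat" where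
  "target g \<equiv> last (wires g)"

lemma act_other: "w \<noteq> target g \<Longrightarrow> act g f w = f w"
  by (cases g) auto

lemma act_cong: "(\<And>w. w \<in> set (wires g) \<Longrightarrow> f w = f' w) \<Longrightarrow> act g f (target g) = act g f' (target g)"
  by (cases g) auto

lemma act_act: "distinct (wires g) \<Longrightarrow> act g (act g f) = f"
  by (cases g) (auto simp: fun_eq_iff)

lemma run_rev:
  "\<forall>g\<in>set gs. distinct (wires g) \<Longrightarrow> run (rev gs) (run gs f) = f"
  by (induction gs arbitrary: f) (auto simp: act_act)

lemma run_other: "w \<notin> target ` set gs \<Longrightarrow> run gs f w = f w"
  by (induction gs arbitrary: f) (auto simp: act_other)

text \<open>No gate of the list touches the target of an earlier one. So each gate still sees its
  initial inputs and its result survives: the list acts as one simultaneous round.\<close>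

lemma run_target:
  assumes "sorted_wrt (\<lambda>g h. target g \<notin> set (wires h)) gs" "g \<in> set gs"
  shows "run gs f (target g) = act g f (target g)"
  using assms
proof (induction gs arbitrary: f)
  case (Cons h gs)
  have tgt: "target k \<in> set (wires k)" for k
    by (cases k) auto
  show ?case
  proof (cases "g \<in> set gs")
    case True
    then have "run gs (act h f) (target g) = act g (act h f) (target g)"
      using Cons by auto
    moreover have "target h \<notin> set (wires g)"
      using Cons.prems(1) True by simp
    then have "act g (act h f) (target g) = act g f (target g)"
      by (intro act_cong act_other) metis
    ultimately show ?thesis by simp
  next
    case False
    then have "g = h" using Cons.prems(2) by simp
    moreover have "target h \<notin> target ` set gs"
      using Cons.prems(1) tgt by fastforce
    ultimately show ?thesis by (simp add: run_other)
  qed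
qed simp

section \<open>From bit assignments to states\<close>

lemma map_act:
  "valid_gate N g \<Longrightarrow> gate_map g (map f [0..<N]) = map (act g f) [0..<N]"
  by (cases g) (auto simp: valid_gate_def nth_list_update intro!: nth_equalityI)

lemma map_run:
  "\<forall>g\<in>set gs. valid_gate N g \<Longrightarrow> fold gate_map gs (map f [0..<N]) = map (run gs f) [0..<N]"
  by (induction gs arbitrary: f) (auto simp: map_act)

lemma length_fold_gate_map [simp]: "length (fold gate_map gs x) = length x"
proof (induction gs arbitrary: x)
  case (Cons g gs)
  then show ?case by (cases g) auto
qed simp

lemma finite_bool_lists [simp]: "finite {x :: bool list. length x = N}"
  using finite_lists_length_eq[of "UNIV :: bool set" N] by simp

text \<open>By linearity the action on basis states determines everything. Membership in
  \<open>states N\<close> makes the empty circuit the identity, as the sum sees lists of length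
  \<open>N\<close> only.\<close>

lemma circuit_op_eq_sum:
  assumes "\<phi> \<in> states N"
  shows "circuit_op N gs \<phi> = (\<lambda>y. \<Sum>x | length x = N. \<phi> x * ket (fold gate_map gs x) y)"
proof (induction gs rule: rev_induct)
  case Nil
  show ?case
  proof
    fix y
    have "(\<Sum>x | length x = N. \<phi> x * ket x y) = (\<Sum>x | length x = N. if y = x then \<phi> x else 0)"
      by (intro sum.cong) (auto simp: ket_def)
    also have "\<dots> = \<phi> y"
      using assms by (auto simp: states_def sum.delta')
    finally show "circuit_op N [] \<phi> y = (\<Sum>x | length x = N. \<phi> x * ket (fold gate_map [] x) y)"
      by (simp add: circuit_op_def)
  qed
next
  case (snoc g gs)
  show ?case
  proof
    fix y
    let ?F = "fold gate_map gs"
    have "circuit_op N (gs @ [g]) \<phi> y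
        = (\<Sum>v | length v = N. (\<Sum>x | length x = N. \<phi> x * ket (?F x) v) * ket (gate_map g v) y)"
      using snoc by (simp add: circuit_op_def gate_op_def)
    also have "\<dots> = (\<Sum>x | length x = N. \<Sum>v | length v = N. \<phi> x * ket (?F x) v * ket (gate_map g v) y)"
      by (subst sum.swap) (simp add: sum_distrib_right)
    also have "\<dots> = (\<Sum>x | length x = N. \<phi> x * ket (gate_map g (?F x)) y)"
    proof (rule sum.cong[OF refl])
      fix x :: "bool list" assume x: "x \<in> {x. length x = N}"
      have "(\<Sum>v | length v = N. \<phi> x * ket (?F x) v * ket (gate_map g v) y)
          = (\<Sum>v | length v = N. if v = ?F x then \<phi> x * ket (gate_map g (?F x)) y else 0)"
        by (intro sum.cong) (auto simp: ket_def)
      then show "(\<Sum>v | length v = N. \<phi> x * ket (?F x) v * ket (gate_map g v) y)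
          = \<phi> x * ket (gate_map g (?F x)) y"
        using x by (simp add: sum.delta)
    qed
    finally show "circuit_op N (gs @ [g]) \<phi> y
        = (\<Sum>x | length x = N. \<phi> x * ket (fold gate_map (gs @ [g]) x) y)"
      by simp
  qed
qed

section \<open>Registers and the computational basis\<close>

lemma length_reg [simp]: "length (reg n a) = n"
  by (simp add: reg_def)

lemma reg_inj: "inj_on (reg n) {..<2^n}"
proof (rule inj_onI)
  fix a b :: nat assume ab: "a \<in> {..<2^n}" "b \<in> {..<2^n}" "reg n a = reg n b"
  have "\<forall>i\<in>set [0..<n]. bit a i = bit b i"
    using ab(3) unfolding reg_def by (simp only: map_eq_conv)
  then have "take_bit n a = take_bit n b"
    by (intro bit_eqI) (auto simp: bit_take_bit_iff)
  then show "a = b"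
    using ab by (simp add: take_bit_nat_eq_self)
qed

text \<open>Injectivity suffices, both sets having \<open>2 ^ n\<close> elements.\<close>

lemma reg_image: "reg n ` {..<2^n} = {x. length x = n}"
proof (rule card_subset_eq)
  show "card (reg n ` {..<2^n}) = card {x :: bool list. length x = n}"
    using card_lists_length_eq[of "UNIV :: bool set" n] by (simp add: card_image[OF reg_inj])
qed auto

text \<open>Brings a sum over all basis states into the triple form of
  \<open>add_op\<close>.\<close>

lemma sum_basis:
  fixes F :: "bool list \<Rightarrow> complex"
  shows "(\<Sum>u | length u = 2*n+1. F u) = (\<Sum>a<2^n. \<Sum>b<2^n. \<Sum>z\<in>UNIV. F (reg n a @ reg n b @ [z]))"
proof -
  let ?h = "\<lambda>(a, b, z). reg n a @ reg n b @ [z]"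
  let ?A = "{..<2^n} \<times> {..<2^n} \<times> (UNIV :: bool set)"
  have "bij_betw ?h ?A {u. length u = 2*n+1}"
    unfolding bij_betw_def
  proof
    show "inj_on ?h ?A"
      by (rule inj_onI) (auto dest: inj_onD[OF reg_inj])
    have "u \<in> ?h ` ?A" if "length u = 2*n+1" for u
    proof -
      have "take n u \<in> reg n ` {..<2^n}" "take n (drop n u) \<in> reg n ` {..<2^n}"
        using that by (auto simp: reg_image)
      then obtain a b where ab: "a < 2^n" "b < 2^n" "take n u = reg n a" "take n (drop n u) = reg n b"
        by auto
      have "length (drop n (drop n u)) = Suc 0"
        using that by simp
      then obtain z where z: "drop n (drop n u) = [z]"
        unfolding length_Suc_conv length_0_conv by blast
      have "u = reg n a @ reg n b @ [z]"
        using ab z by (metis append_take_drop_id)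
      then show ?thesis
        using ab by (intro image_eqI[of _ _ "(a, b, z)"]) auto
    qed
    then show "?h ` ?A = {u. length u = 2*n+1}"
      by auto
  qed
  then have "(\<Sum>u | length u = 2*n+1. F u) = (\<Sum>p\<in>?A. F (?h p))"
    by (rule sum.reindex_bij_betw[symmetric])
  then show ?thesis
    by (simp add: sum.cartesian_product case_prod_unfold)
qed

text \<open>Reduces the operator equation to basis states with cleared ancillas, the only ones that
  can have a nonzero amplitude initially.\<close>

lemma implements_addI:
  assumes valid: "\<forall>g\<in>set gs. valid_gate (2*n+1+k) g"
    and basis: "\<And>a b z. a < 2^n \<Longrightarrow> b < 2^n \<Longrightarrow>
      fold gate_map gs (reg n a @ reg n b @ [z] @ replicate k False)
        = reg n a @ reg n ((a + b) mod 2^n) @ [z \<noteq> bit (a + b) n] @ replicate k False"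
  shows "implements_add n k gs"
  unfolding implements_add_def
proof (intro conjI ballI valid[rule_format])
  fix \<psi> assume \<psi>: "\<psi> \<in> states (2*n+1)"
  let ?M = "2*n+1" and ?z = "replicate k False" and ?F = "fold gate_map gs"
  let ?\<phi> = "tensor ?M \<psi> (ket ?z)"
  have st: "?\<phi> \<in> states (?M + k)"
    unfolding states_def
  proof (intro CollectI allI impI)
    fix x :: "bool list" assume x: "length x \<noteq> ?M + k"
    have "length (take ?M x) \<noteq> ?M \<or> length (drop ?M x) \<noteq> k"
      using x by auto
    then have "\<psi> (take ?M x) = 0 \<or> drop ?M x \<noteq> ?z"
      using \<psi> unfolding states_def by (auto dest: arg_cong[where f = length])
    then show "?\<phi> x = 0"
      by (auto simp: tensor_def ket_def)
  qed
  show "circuit_op (?M + k) gs ?\<phi> = tensor ?M (add_op n \<psi>) (ket ?z)"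
  proof
    fix y
    have "circuit_op (?M + k) gs ?\<phi> y = (\<Sum>x | length x = ?M + k. ?\<phi> x * ket (?F x) y)"
      by (rule fun_cong[OF circuit_op_eq_sum[OF st]])
    also have "\<dots> = (\<Sum>x\<in>(\<lambda>u. u @ ?z) ` {u. length u = ?M}. ?\<phi> x * ket (?F x) y)"
    proof (rule sum.mono_neutral_right)
      have "?\<phi> x = 0" if x: "length x = ?M + k" "x \<notin> (\<lambda>u. u @ ?z) ` {u. length u = ?M}" for x
      proof -
        have "drop ?M x \<noteq> ?z"
        proof
          assume "drop ?M x = ?z"
          then have "x = take ?M x @ ?z" by (metis append_take_drop_id)
          moreover have "length (take ?M x) = ?M" using x(1) by simp
          ultimately show False using x(2) by blast
        qed
        then show ?thesis by (simp add: tensor_def ket_def)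
      qed
      then show "\<forall>x\<in>{x. length x = ?M + k} - (\<lambda>u. u @ ?z) ` {u. length u = ?M}. ?\<phi> x * ket (?F x) y = 0"
        by simp
    qed auto
    also have "\<dots> = (\<Sum>u | length u = ?M. \<psi> u * ket (?F (u @ ?z)) y)"
      by (subst sum.reindex) (auto simp: inj_on_def tensor_def ket_def intro!: sum.cong)
    also have "\<dots> = (\<Sum>a<2^n. \<Sum>b<2^n. \<Sum>z\<in>UNIV. \<psi> (reg n a @ reg n b @ [z]) *
        ket (?F (reg n a @ reg n b @ [z] @ ?z)) y)"
      unfolding sum_basis by simp
    also have "\<dots> = (\<Sum>a<2^n. \<Sum>b<2^n. \<Sum>z\<in>UNIV. \<psi> (reg n a @ reg n b @ [z]) *
        ket (reg n a @ reg n ((a + b) mod 2^n) @ [z \<noteq> bit (a + b) n]) (take ?M y) * ket ?z (drop ?M y))"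
    proof (intro sum.cong refl)
      fix a b :: nat and z assume ab: "a \<in> {..<2^n}" "b \<in> {..<2^n}"
      let ?r = "reg n a @ reg n ((a + b) mod 2^n) @ [z \<noteq> bit (a + b) n]"
      have "y = ?r @ ?z \<longleftrightarrow> take ?M y = ?r \<and> drop ?M y = ?z"
      proof
        assume "take ?M y = ?r \<and> drop ?M y = ?z"
        then show "y = ?r @ ?z" by (metis append_take_drop_id)
      qed simp
      then have "ket (?r @ ?z) y = ket ?r (take ?M y) * ket ?z (drop ?M y)"
        unfolding ket_def by (simp only: of_bool_conj)
      then show "\<psi> (reg n a @ reg n b @ [z]) * ket (?F (reg n a @ reg n b @ [z] @ ?z)) y
        = \<psi> (reg n a @ reg n b @ [z]) * ket ?r (take ?M y) * ket ?z (drop ?M y)"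
        using basis[of a b z] ab by (simp add: mult.assoc)
    qed
    also have "\<dots> = tensor ?M (add_op n \<psi>) (ket ?z) y"
      by (simp add: tensor_def add_op_def sum_distrib_right)
    finally show "circuit_op (?M + k) gs ?\<phi> y = tensor ?M (add_op n \<psi>) (ket ?z) y" .
  qed
qed

section \<open>Toffoli depth\<close>

lemma layering_length: "toffoli_layering gs (length gs) Suc"
  by (auto simp: toffoli_layering_def)

lemma
  assumes "toffoli_layering gs d L"
  shows layering_le: "i < length gs \<Longrightarrow> L i \<le> d"
    and layering_pos: "i < length gs \<Longrightarrow> is_Toffoli (gs ! i) \<Longrightarrow> 1 \<le> L i"
    and layering_less: "i < j \<Longrightarrow> j < length gs \<Longrightarrow> set (wires (gs ! i)) \<inter> set (wires (gs ! j)) \<noteq> {} \<Longrightarrow>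
      if is_Toffoli (gs ! j) then L i < L j else L i \<le> L j"
  using assms unfolding toffoli_layering_def by blast+

lemma toffoli_depth_le: "toffoli_layering gs d L \<Longrightarrow> toffoli_depth gs \<le> d"
  unfolding toffoli_depth_def by (rule Least_le) blast

lemma toffoli_depth_attained:
  obtains L where "toffoli_layering gs (toffoli_depth gs) L"
  using LeastI_ex[of "\<lambda>d. \<exists>L. toffoli_layering gs d L"] layering_length
  unfolding toffoli_depth_def by blast

lemma toffoli_depth_le_length: "toffoli_depth gs \<le> length gs"
  by (rule toffoli_depth_le[OF layering_length])

lemma toffoli_depth_no_Toffoli: "\<forall>g\<in>set gs. \<not> is_Toffoli g \<Longrightarrow> toffoli_depth gs = 0"
  using toffoli_depth_le[of gs 0 "\<lambda>_. 0"] by (simp add: toffoli_layering_def)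

text \<open>The second schedule is shifted behind the whole first one.\<close>

lemma toffoli_depth_append: "toffoli_depth (xs @ ys) \<le> toffoli_depth xs + toffoli_depth ys"
proof -
  let ?d = "toffoli_depth xs" and ?e = "toffoli_depth ys" and ?m = "length xs"
  obtain L M where L: "toffoli_layering xs ?d L" and M: "toffoli_layering ys ?e M"
    by (meson toffoli_depth_attained)
  have "toffoli_layering (xs @ ys) (?d + ?e) (\<lambda>i. if i < ?m then L i else ?d + M (i - ?m))"
    unfolding toffoli_layering_def
  proof (intro conjI allI impI)
    fix i assume "i < length (xs @ ys)"
    then have "i < ?m \<or> i - ?m < length ys" by auto
    then show "(if i < ?m then L i else ?d + M (i - ?m)) \<le> ?d + ?e"
      "is_Toffoli ((xs @ ys) ! i) \<Longrightarrow> 1 \<le> (if i < ?m then L i else ?d + M (i - ?m))"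
      using layering_le[OF L, of i] layering_le[OF M, of "i - ?m"]
        layering_pos[OF L, of i] layering_pos[OF M, of "i - ?m"]
      by (auto simp: nth_append split: if_splits)
  next
    fix j i assume j: "j < length (xs @ ys)" and i: "i < j"
      and w: "set (wires ((xs @ ys) ! i)) \<inter> set (wires ((xs @ ys) ! j)) \<noteq> {}"
    consider "j < ?m" | "i < ?m" "?m \<le> j" | "?m \<le> i" by linarith
    then show "if is_Toffoli ((xs @ ys) ! j)
      then (if i < ?m then L i else ?d + M (i - ?m)) < (if j < ?m then L j else ?d + M (j - ?m))
      else (if i < ?m then L i else ?d + M (i - ?m)) \<le> (if j < ?m then L j else ?d + M (j - ?m))"
    proof cases
      case 1
      then show ?thesis
        using layering_less[OF L i] i w by (simp add: nth_append)
    next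
      case 2
      then have "L i \<le> ?d" using layering_le[OF L] by simp
      \<comment> \<open>Toffoli layers of the second list start at 1, hence strictly after layer
        \<open>?d\<close>, which the first list may use; other gates may share the index
        \<open>?d\<close>.\<close>
      moreover have "is_Toffoli (ys ! (j - ?m)) \<longrightarrow> 1 \<le> M (j - ?m)"
        using layering_pos[OF M, of "j - ?m"] j 2 by auto
      ultimately show ?thesis
        using 2 by (auto simp: nth_append)
    next
      case 3
      then have "if is_Toffoli (ys ! (j - ?m)) then M (i - ?m) < M (j - ?m) else M (i - ?m) \<le> M (j - ?m)"
        using layering_less[OF M, of "i - ?m" "j - ?m"] i j w by (simp add: nth_append)
      then show ?thesis
        using 3 i by (auto simp: nth_append split: if_splits)
    qed
  qed
  then show ?thesis by (rule toffoli_depth_le)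
qed

text \<open>All gates being Toffoli gates, their layers lie in 1, ..., \<open>?d\<close>, and
  replacing a layer \<open>l\<close> by \<open>?d + 1 - l\<close> reverses the strict order.\<close>

lemma toffoli_depth_rev_le:
  assumes "\<forall>g\<in>set gs. is_Toffoli g"
  shows "toffoli_depth (rev gs) \<le> toffoli_depth gs"
proof -
  let ?d = "toffoli_depth gs" and ?m = "length gs"
  obtain L where L: "toffoli_layering gs ?d L"
    by (rule toffoli_depth_attained)
  have T: "is_Toffoli (gs ! i)" if "i < ?m" for i
    using assms that by simp
  have L1: "1 \<le> L i \<and> L i \<le> ?d" if "i < ?m" for i
    using layering_le[OF L that] layering_pos[OF L that T[OF that]] by simp
  have "toffoli_layering (rev gs) ?d (\<lambda>i. ?d + 1 - L (?m - Suc i))"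
    unfolding toffoli_layering_def
  proof (intro conjI allI impI)
    fix i assume "i < length (rev gs)"
    then have "?m - Suc i < ?m" by auto
    from L1[OF this] show "?d + 1 - L (?m - Suc i) \<le> ?d" "1 \<le> ?d + 1 - L (?m - Suc i)"
      by auto
  next
    fix j i assume j: "j < length (rev gs)" and i: "i < j"
      and w: "set (wires (rev gs ! i)) \<inter> set (wires (rev gs ! j)) \<noteq> {}"
    have lt: "?m - Suc j < ?m - Suc i" "?m - Suc i < ?m" using i j by auto
    have "set (wires (gs ! (?m - Suc j))) \<inter> set (wires (gs ! (?m - Suc i))) \<noteq> {}"
      using w i j by (auto simp: rev_nth)
    then have "L (?m - Suc j) < L (?m - Suc i)"
      using layering_less[OF L lt] T[OF lt(2)] by simp
    then show "if is_Toffoli (rev gs ! j) then ?d + 1 - L (?m - Suc i) < ?d + 1 - L (?m - Suc j)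
      else ?d + 1 - L (?m - Suc i) \<le> ?d + 1 - L (?m - Suc j)"
      using L1[OF lt(2)] by auto
  qed
  then show ?thesis by (rule toffoli_depth_le)
qed

text \<open>Toffoli gates sharing a wire lie in pairwise different layers. This is the source of the
  lower bound on the depth.\<close>

lemma toffoli_depth_ge:
  "length (filter (\<lambda>g. is_Toffoli g \<and> w \<in> set (wires g)) gs) \<le> toffoli_depth gs"
proof -
  obtain L where L: "toffoli_layering gs (toffoli_depth gs) L"
    by (rule toffoli_depth_attained)
  let ?I = "{i. i < length gs \<and> is_Toffoli (gs ! i) \<and> w \<in> set (wires (gs ! i))}"
  have less: "L i < L j" if "i \<in> ?I" "j \<in> ?I" "i < j" for i j
  proof -
    have "set (wires (gs ! i)) \<inter> set (wires (gs ! j)) \<noteq> {}" using that by blast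
    then show ?thesis
      using layering_less[OF L that(3)] that by simp
  qed
  have "inj_on L ?I"
  proof (rule linorder_inj_onI')
    fix i j assume "i \<in> ?I" "j \<in> ?I" "i < j"
    from less[OF this] show "L i \<noteq> L j" by simp
  qed
  moreover have "L ` ?I \<subseteq> {1..toffoli_depth gs}"
    using layering_le[OF L] layering_pos[OF L] by auto
  ultimately have "card ?I \<le> card {1..toffoli_depth gs}"
    by (rule card_inj_on_le) simp
  then show ?thesis
    by (simp add: length_filter_conv_card)
qed

text \<open>Explicit time stamps let a schedule be assembled together with the gate list. Strict
  increase along shared wires serves both cases of \<open>toffoli_layering\<close>.\<close>

lemma toffoli_depth_timed_le:
  assumes "\<forall>(t, g)\<in>set xs. 0 < t \<and> t \<le> d"
    and "sorted_wrt (\<lambda>(t, g) (u, h). set (wires g) \<inter> set (wires h) \<noteq> {} \<longrightarrow> t < u) xs"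
  shows "toffoli_depth (map snd xs) \<le> d"
proof (rule toffoli_depth_le)
  show "toffoli_layering (map snd xs) d (\<lambda>i. fst (xs ! i))"
    unfolding toffoli_layering_def
  proof (intro conjI allI impI)
    fix i assume "i < length (map snd xs)"
    then have "xs ! i \<in> set xs" by simp
    with assms(1) show "fst (xs ! i) \<le> d" "1 \<le> fst (xs ! i)" by (auto simp: Suc_le_eq)
  next
    fix j i assume ij: "j < length (map snd xs)" "i < j"
      and "set (wires (map snd xs ! i)) \<inter> set (wires (map snd xs ! j)) \<noteq> {}"
    then have "fst (xs ! i) < fst (xs ! j)"
      using sorted_wrt_nth_less[OF assms(2), of i j] by (simp add: case_prod_unfold)
    then show "if is_Toffoli (map snd xs ! j) then fst (xs ! i) < fst (xs ! j) else fst (xs ! i) \<le> fst (xs ! j)"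
      by simp
  qed
qed

section \<open>The parallel Toffoli ladder\<close>

text \<open>The ladder replaces \<open>y (i + 1)\<close> by \<open>y (i + 1) \<oplus> p (i + 1) \<cdot> y i\<close> for \<open>i = 0, 1, \<dots>\<close> in this order.
  As a prefix computation, it halves the problem: the two multipliers of an odd and the preceding
  even index are merged into one. The wire \<open>q t j\<close> carries the product of the multipliers
  \<open>p i\<close> for \<open>j * 2 ^ t \<le> i < (j + 1) * 2 ^ t\<close>; so \<open>q 0\<close> are the multipliers themselves, and the
  wires at the levels \<open>t \<ge> 1\<close> are ancillas.\<close>

definition prop_round :: "nat \<Rightarrow> (nat \<Rightarrow> nat \<Rightarrow> nat) \<Rightarrow> gate list" where
  "prop_round m q = map (\<lambda>j. Toffoli (q 0 (2*j)) (q 0 (2*j+1)) (q 1 j)) [1..<m div 2]"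

text \<open>Composing the maps of the positions \<open>2*j\<close> and \<open>2*j+1\<close> gives
  the constant term \<open>x (2*j+1) \<oplus> p (2*j+1) \<cdot> x (2*j)\<close>, formed here on the
  odd wire. For \<open>j\<close> \<ge> 1 the multiplier of the composition comes from
  \<open>prop_round\<close>.\<close>

definition up_round :: "nat \<Rightarrow> (nat \<Rightarrow> nat) \<Rightarrow> (nat \<Rightarrow> nat \<Rightarrow> nat) \<Rightarrow> gate list" where
  "up_round m y q = map (\<lambda>j. Toffoli (y (2*j)) (q 0 (2*j+1)) (y (2*j+1))) [0..<m div 2]"

text \<open>Once the odd positions are final, each even one is a single step behind its predecessor;
  \<open>(m-1) div 2\<close> counts the positions \<open>2*j+2\<close> below
  \<open>m\<close>.\<close>

definition down_round :: "nat \<Rightarrow> (nat \<Rightarrow> nat) \<Rightarrow> (nat \<Rightarrow> nat \<Rightarrow> nat) \<Rightarrow> gate list" where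
  "down_round m y q =
     map (\<lambda>j. Toffoli (y (2*j+1)) (q 0 (2*j+2)) (y (2*j+2))) [0..<(m-1) div 2]"

text \<open>The recursive call solves the halved problem on the odd positions, its multipliers being
  the products one level up; the closing \<open>prop_round\<close> clears these products
  again.\<close>

fun ladder :: "nat \<Rightarrow> (nat \<Rightarrow> nat) \<Rightarrow> (nat \<Rightarrow> nat \<Rightarrow> nat) \<Rightarrow> gate list" where
  "ladder m y q = (if m < 2 then [] else
     prop_round m q @ up_round m y q @ ladder (m div 2) (\<lambda>j. y (2*j+1)) (\<lambda>t. q (Suc t)) @
     down_round m y q @ prop_round m q)"

declare ladder.simps [simp del]

text \<open>The blocks of multipliers that lie completely below \<open>m\<close>. Block 0 is absent
  at every level: position 0 has no predecessor, so no product containing \<open>p 0\<close> is ever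
  needed.\<close>

definition slots :: "nat \<Rightarrow> (nat \<times> nat) set" where
  "slots m = {(t, j). 1 \<le> j \<and> (j + 1) * 2 ^ t \<le> m}"

definition layout :: "nat \<Rightarrow> (nat \<Rightarrow> nat) \<Rightarrow> (nat \<Rightarrow> nat \<Rightarrow> nat) \<Rightarrow> bool" where
  "layout m y q \<longleftrightarrow> inj_on y {..<m} \<and> inj_on (case_prod q) (slots m) \<and>
     y ` {..<m} \<inter> case_prod q ` slots m = {}"

lemma slots_0 [simp]: "(0, j) \<in> slots m \<longleftrightarrow> 1 \<le> j \<and> j < m"
  by (auto simp: slots_def)

lemma slots_Suc [simp]: "(Suc t, j) \<in> slots m \<longleftrightarrow> (t, j) \<in> slots (m div 2)"
proof -
  have "(j + 1) * 2 ^ Suc t \<le> m \<longleftrightarrow> (j + 1) * 2 ^ t * 2 \<le> m"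
    by (simp add: mult.commute mult.left_commute)
  also have "\<dots> \<longleftrightarrow> (j + 1) * 2 ^ t \<le> m div 2"
    by (rule less_eq_div_iff_mult_less_eq[symmetric]) simp
  finally show ?thesis
    by (simp add: slots_def)
qed

text \<open>Rewrite rules for the distinctness of wires; the last two are the two orientations in
  which the simplifier meets the same disequality.\<close>

lemma layoutD:
  assumes "layout m y q"
  shows layout_y: "i < m \<Longrightarrow> j < m \<Longrightarrow> y i = y j \<longleftrightarrow> i = j"
    and layout_q: "(t, i) \<in> slots m \<Longrightarrow> (u, j) \<in> slots m \<Longrightarrow> q t i = q u j \<longleftrightarrow> t = u \<and> i = j"
    and layout_yq: "i < m \<Longrightarrow> (u, j) \<in> slots m \<Longrightarrow> y i \<noteq> q u j"
    and layout_qy: "i < m \<Longrightarrow> (u, j) \<in> slots m \<Longrightarrow> q u j \<noteq> y i"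
  using assms unfolding layout_def inj_on_def by (fastforce simp: disjoint_iff)+

lemma layout_half:
  assumes "layout m y q"
  shows "layout (m div 2) (\<lambda>j. y (2*j+1)) (\<lambda>t. q (Suc t))"
  unfolding layout_def
proof (intro conjI)
  show "inj_on (\<lambda>j. y (2*j+1)) {..<m div 2}"
    by (rule inj_onI) (use layout_y[OF assms] in force)
  show "inj_on (\<lambda>(t, j). q (Suc t) j) (slots (m div 2))"
    by (rule inj_onI) (use layout_q[OF assms, of "Suc _" _ "Suc _"] in force)
  show "(\<lambda>j. y (2*j+1)) ` {..<m div 2} \<inter> (\<lambda>(t, j). q (Suc t) j) ` slots (m div 2) = {}"
    using layout_yq[OF assms, of "2 * _ + 1" "Suc _"] by force
qed

lemma wires_rounds:
  "g \<in> set (prop_round m q) \<Longrightarrow> \<exists>j. 1 \<le> j \<and> j < m div 2 \<and> g = Toffoli (q 0 (2*j)) (q 0 (2*j+1)) (q 1 j)"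
  "g \<in> set (up_round m y q) \<Longrightarrow> \<exists>j<m div 2. g = Toffoli (y (2*j)) (q 0 (2*j+1)) (y (2*j+1))"
  "g \<in> set (down_round m y q) \<Longrightarrow> \<exists>j<(m-1) div 2. g = Toffoli (y (2*j+1)) (q 0 (2*j+2)) (y (2*j+2))"
  by (auto simp: prop_round_def up_round_def down_round_def)

lemma ladder_wires:
  assumes "layout m y q" "g \<in> set (ladder m y q)"
  shows "is_Toffoli g \<and> distinct (wires g) \<and> set (wires g) \<subseteq> y ` {..<m} \<union> case_prod q ` slots m"
  using assms
proof (induction m y q rule: ladder.induct)
  case (1 m y q)
  note lay = layoutD[OF "1.prems"(1)]
  have m2: "\<not> m < 2"
    using "1.prems"(2) by (auto simp: ladder.simps[of m] split: if_splits)
  have q: "q t j \<in> case_prod q ` slots m" if "(t, j) \<in> slots m" for t j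
    using that by force
  consider "g \<in> set (prop_round m q)" | "g \<in> set (up_round m y q)" | "g \<in> set (down_round m y q)"
    | "g \<in> set (ladder (m div 2) (\<lambda>j. y (2*j+1)) (\<lambda>t. q (Suc t)))"
    using "1.prems"(2) m2 by (auto simp: ladder.simps[of m])
  then show ?case
  proof cases
    case 1
    then obtain j where "1 \<le> j" "j < m div 2" "g = Toffoli (q 0 (2*j)) (q 0 (2*j+1)) (q 1 j)"
      using wires_rounds(1) by blast
    then show ?thesis
      by (auto simp: lay intro!: q)
  next
    case 2
    then obtain j where "j < m div 2" "g = Toffoli (y (2*j)) (q 0 (2*j+1)) (y (2*j+1))"
      using wires_rounds(2) by blast
    then show ?thesis
      by (auto simp: lay intro!: q)
  next
    case 3
    then obtain j where "j < (m-1) div 2" "g = Toffoli (y (2*j+1)) (q 0 (2*j+2)) (y (2*j+2))"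
      using wires_rounds(3) by blast
    then show ?thesis
      by (auto simp: lay intro!: q)
  next
    case 4
    have "(\<lambda>j. y (2*j+1)) ` {..<m div 2} \<subseteq> y ` {..<m}"
      by auto
    moreover have "(\<lambda>(t, j). q (Suc t) j) ` slots (m div 2) \<subseteq> case_prod q ` slots m"
      using q by (auto simp del: One_nat_def)
    ultimately show ?thesis
      using "1.IH"[OF m2 layout_half[OF "1.prems"(1)] 4] by blast
  qed
qed

text \<open>The sequential ladder, as the reference against which the parallel one is
  verified.\<close>

fun ladder_value :: "(nat \<Rightarrow> bool) \<Rightarrow> (nat \<Rightarrow> bool) \<Rightarrow> nat \<Rightarrow> bool" where
  "ladder_value x p 0 = x 0"
| "ladder_value x p (Suc i) = (x (Suc i) \<noteq> (p (Suc i) \<and> ladder_value x p i))"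

text \<open>Induction on the halving. The second conjunct includes that ancillas return to zero and
  multipliers stay intact, which the rounds after the recursive call rely on.\<close>

lemma run_ladder:
  assumes "layout m y q" "\<And>t j. (Suc t, j) \<in> slots m \<Longrightarrow> \<not> f (q (Suc t) j)"
  shows "(\<forall>i<m. run (ladder m y q) f (y i) = ladder_value (f \<circ> y) (f \<circ> q 0) i) \<and>
         (\<forall>w. w \<notin> y ` {..<m} \<longrightarrow> run (ladder m y q) f w = f w)"
  using assms
proof (induction m y q arbitrary: f rule: ladder.induct)
  case (1 m y q)
  note lay = layoutD[OF "1.prems"(1)]
  show ?case
  proof (cases "m < 2")
    case True
    then show ?thesis
      by (auto simp: ladder.simps[of m] less_Suc_eq numeral_2_eq_2)
  next
    case m2: False
    let ?y = "\<lambda>j. y (2*j+1)" and ?q = "\<lambda>t. q (Suc t)"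
    \<comment> \<open>The assignments after each of the five parts of the ladder.\<close>
    define f1 where "f1 = run (prop_round m q) f"
    define f2 where "f2 = run (up_round m y q) f1"
    define f3 where "f3 = run (ladder (m div 2) ?y ?q) f2"
    define f4 where "f4 = run (down_round m y q) f3"
    define f5 where "f5 = run (prop_round m q) f4"
    have f5: "run (ladder m y q) f = f5"
      using m2 by (simp add: ladder.simps[of m] f1_def f2_def f3_def f4_def f5_def)
    \<comment> \<open>Within a round no gate touches the target of an earlier one, so
      \<open>run_target\<close> evaluates the round in one go.\<close>
    have sP: "sorted_wrt (\<lambda>g h. target g \<notin> set (wires h)) (prop_round m q)"
      by (auto simp: prop_round_def sorted_wrt_map lay intro!: sorted_wrt_mono_rel[OF _ sorted_wrt_upt])
    have sU: "sorted_wrt (\<lambda>g h. target g \<notin> set (wires h)) (up_round m y q)"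
      by (auto simp: up_round_def sorted_wrt_map lay intro!: sorted_wrt_mono_rel[OF _ sorted_wrt_upt])
    have sD: "sorted_wrt (\<lambda>g h. target g \<notin> set (wires h)) (down_round m y q)"
      by (auto simp: down_round_def sorted_wrt_map lay intro!: sorted_wrt_mono_rel[OF _ sorted_wrt_upt])
    have P: "run (prop_round m q) g (q 1 j) = (g (q 1 j) \<noteq> (g (q 0 (2*j)) \<and> g (q 0 (2*j+1))))"
      if "1 \<le> j" "j < m div 2" for j g
      using run_target[OF sP, of "Toffoli (q 0 (2*j)) (q 0 (2*j+1)) (q 1 j)" g] that
      by (auto simp: prop_round_def lay)
    have P': "run (prop_round m q) g w = g w" if "\<And>j. 1 \<le> j \<Longrightarrow> j < m div 2 \<Longrightarrow> w \<noteq> q 1 j" for w g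
      using that by (intro run_other) (simp add: prop_round_def image_iff Ball_def)
    have U: "run (up_round m y q) g (y (2*j+1)) = (g (y (2*j+1)) \<noteq> (g (y (2*j)) \<and> g (q 0 (2*j+1))))"
      if "j < m div 2" for j g
      using run_target[OF sU, of "Toffoli (y (2*j)) (q 0 (2*j+1)) (y (2*j+1))" g] that
      by (auto simp: up_round_def lay)
    have U': "run (up_round m y q) g w = g w" if "\<And>j. j < m div 2 \<Longrightarrow> w \<noteq> y (2*j+1)" for w g
      using that by (intro run_other) (simp add: up_round_def image_iff Ball_def)
    have D: "run (down_round m y q) g (y (2*j+2)) = (g (y (2*j+2)) \<noteq> (g (y (2*j+1)) \<and> g (q 0 (2*j+2))))"
      if "j < (m-1) div 2" for j g
      using run_target[OF sD, of "Toffoli (y (2*j+1)) (q 0 (2*j+2)) (y (2*j+2))" g] that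
      by (auto simp: down_round_def lay)
    have D': "run (down_round m y q) g w = g w" if "\<And>j. j < (m-1) div 2 \<Longrightarrow> w \<noteq> y (2*j+2)" for w g
      using that by (intro run_other) (simp add: down_round_def image_iff Ball_def)
    have f2y: "f2 (y (2*j+1)) = (f (y (2*j+1)) \<noteq> (f (y (2*j)) \<and> f (q 0 (2*j+1))))" if "j < m div 2" for j
    proof -
      have "f1 (y (2*j+1)) = f (y (2*j+1))" "f1 (y (2*j)) = f (y (2*j))"
        "f1 (q 0 (2*j+1)) = f (q 0 (2*j+1))"
        unfolding f1_def using that by (auto intro!: P' simp: lay)
      then show ?thesis
        using U[OF that] by (simp add: f2_def)
    qed
    have even_odd: "y (2*j) \<noteq> y (2*i+1)" if "2*j < m" "i < m div 2" for i j
      using that layout_y[OF "1.prems"(1), of "2*j" "2*i+1"] by presburger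
    have f2y': "f2 (y (2*j)) = f (y (2*j))" if "2*j < m" for j
    proof -
      have "f2 (y (2*j)) = f1 (y (2*j))"
        unfolding f2_def by (intro U' even_odd that)
      also have "\<dots> = f (y (2*j))"
        unfolding f1_def using that by (intro P') (auto simp: lay)
      finally show ?thesis .
    qed
    \<comment> \<open>The ancillas of level 1 now hold products, while the higher ones are still
      zero, as the induction hypothesis demands.\<close>
    have f2q: "f2 (q (Suc t) j) = (t = 0 \<and> f (q 0 (2*j)) \<and> f (q 0 (2*j+1)))"
      if "(Suc t, j) \<in> slots m" for t j
    proof -
      have "f2 (q (Suc t) j) = f1 (q (Suc t) j)"
        unfolding f2_def using that by (intro U') (auto simp: lay simp del: slots_Suc)
      also have "\<dots> = (t = 0 \<and> f (q 0 (2*j)) \<and> f (q 0 (2*j+1)))"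
      proof (cases t)
        case 0
        then show ?thesis
          using that "1.prems"(2)[of 0 j] P[of j f] by (simp add: f1_def)
      next
        case (Suc u)
        have "f1 (q (Suc t) j) = f (q (Suc t) j)"
          unfolding f1_def
        proof (rule P')
          fix i assume "1 \<le> i" "i < m div 2"
          then have "(1, i) \<in> slots m" by simp
          from layout_q[OF "1.prems"(1) that this] Suc show "q (Suc t) j \<noteq> q 1 i" by simp
        qed
        then show ?thesis
          using "1.prems"(2)[OF that] Suc by simp
      qed
      finally show ?thesis .
    qed
    have f2z: "\<not> f2 (q (Suc (Suc t)) j)" if "(Suc t, j) \<in> slots (m div 2)" for t j
      using f2q[of "Suc t" j] that by simp
    note IH = "1.IH"[OF m2 layout_half[OF "1.prems"(1)], of f2]
    have IH_y: "f3 (?y i) = ladder_value (f2 \<circ> ?y) (f2 \<circ> ?q 0) i" if "i < m div 2" for i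
      using IH f2z that unfolding f3_def by blast
    have IH_other: "f3 w = f2 w" if "w \<notin> ?y ` {..<m div 2}" for w
      using IH f2z that unfolding f3_def by blast
    let ?S = "ladder_value (f \<circ> y) (f \<circ> q 0)"
    \<comment> \<open>The halving itself: the ladder of merged values and multipliers visits just
      the odd positions of the full one.\<close>
    have halve: "ladder_value (f2 \<circ> ?y) (f2 \<circ> ?q 0) j = ?S (2*j+1)" if "j < m div 2" for j
      using that
    proof (induction j)
      case 0
      then show ?case using f2y[of 0] by auto
    next
      case (Suc j)
      then show ?case using f2y[of "Suc j"] f2q[of 0 "Suc j"] by auto
    qed
    have f3_odd: "f3 (y (2*j+1)) = ?S (2*j+1)" if "j < m div 2" for j
      using IH_y[OF that] halve[OF that] by (simp only:)
    have f3_other: "f3 w = f2 w" if "\<And>j. j < m div 2 \<Longrightarrow> w \<noteq> y (2*j+1)" for w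
      using that by (intro IH_other) auto
    have f3_even: "f3 (y (2*j)) = f (y (2*j))" if "2*j < m" for j
      using f2y'[OF that] f3_other[OF even_odd[OF that]] by simp
    have f3_p: "f3 (q 0 j) = f (q 0 j)" if "1 \<le> j" "j < m" for j
    proof -
      have "f3 (q 0 j) = f2 (q 0 j)"
        using that by (intro f3_other) (auto simp: lay)
      also have "\<dots> = f1 (q 0 j)"
        unfolding f2_def using that by (intro U') (auto simp: lay)
      also have "\<dots> = f (q 0 j)"
        unfolding f1_def using that by (intro P') (auto simp: lay)
      finally show ?thesis .
    qed
    have f4_odd: "f4 (y (2*j+1)) = ?S (2*j+1)" if "j < m div 2" for j
    proof -
      have "f4 (y (2*j+1)) = f3 (y (2*j+1))"
        unfolding f4_def using that by (intro D') (auto simp: lay, presburger)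
      then show ?thesis using f3_odd[OF that] by simp
    qed
    have f4_even: "f4 (y (2*j)) = ?S (2*j)" if "2*j < m" for j
    proof (cases j)
      case 0
      have "f4 (y 0) = f3 (y 0)"
        unfolding f4_def using that by (intro D') (auto simp: lay)
      then show ?thesis using f3_even[of 0] that 0 by simp
    next
      case (Suc i)
      then have i: "i < (m-1) div 2" "i < m div 2" "2*i+2 < m" using that by auto
      then show ?thesis
        using D[OF i(1), of f3] f3_odd[OF i(2)] f3_even[OF that] f3_p[of "2*i+2"] Suc
        by (auto simp: f4_def)
    qed
    have f5_y: "f5 (y i) = ?S i" if "i < m" for i
    proof -
      have "f5 (y i) = f4 (y i)"
        unfolding f5_def using that by (intro P') (auto simp: lay)
      also have "\<dots> = ?S i"
        using f4_even f4_odd that by (cases "even i") (auto elim!: evenE oddE)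
      finally show ?thesis .
    qed
    have f5_other: "f5 w = f w" if w: "w \<notin> y ` {..<m}" for w
    proof -
      have f4w: "f4 w = f2 w"
      proof -
        have "f4 w = f3 w"
          unfolding f4_def using w by (intro D') auto
        also have "\<dots> = f2 w"
          using w by (intro f3_other) auto
        finally show ?thesis .
      qed
      have f2w: "f2 w = f1 w"
        unfolding f2_def using w by (intro U') auto
      show ?thesis
      \<comment> \<open>Outside \<open>y\<close>, only the level 1 ancillas have changed. The
        multipliers being unchanged, the second \<open>prop_round\<close> adds the same products and
        so clears them.\<close>
      proof (cases "\<exists>j. 1 \<le> j \<and> j < m div 2 \<and> w = q 1 j")
        case True
        then obtain j where j: "1 \<le> j" "j < m div 2" "w = q 1 j" by blast
        have "f4 (q 0 i) = f (q 0 i)" if "1 \<le> i" "i < m" for i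
          unfolding f4_def using f3_p[OF that] that by (subst D') (auto simp: lay)
        then have "f4 (q 0 (2*j)) = f (q 0 (2*j))" "f4 (q 0 (2*j+1)) = f (q 0 (2*j+1))"
          using j by auto
        then have "\<not> f5 w"
          using P[OF j(1,2), of f4] f4w f2q[of 0 j] j by (simp add: f5_def)
        then show ?thesis
          using "1.prems"(2)[of 0 j] j by simp
      next
        case False
        then have "f5 w = f4 w" "f1 w = f w"
          unfolding f5_def f1_def by (intro P'; blast)+
        then show ?thesis
          using f4w f2w by simp
      qed
    qed
    show ?thesis
      unfolding f5 using f5_y f5_other by blast
  qed
qed

text \<open>A ladder gets the times \<open>s + 1\<close> to \<open>s + d\<close>, and its gates on
  the wires \<open>y\<close> only the strict interior. So the product rounds of the recursive call,
  which avoid these wires, run in parallel with the outer up and down rounds, and each level costs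
  two layers instead of four.\<close>

lemma ladder_schedule:
  assumes "layout m y q"
  defines "d \<equiv> 2 * floor_log m + 2"
  shows "\<exists>xs. map snd xs = ladder m y q \<and>
    (\<forall>(t, g)\<in>set xs. s < t \<and> t \<le> s + d \<and>
      (set (wires g) \<inter> y ` {..<m} \<noteq> {} \<longrightarrow> s + 1 < t \<and> t < s + d)) \<and>
    sorted_wrt (\<lambda>(t, g) (u, h). set (wires g) \<inter> set (wires h) \<noteq> {} \<longrightarrow> t < u) xs"
  using assms(1) unfolding d_def
proof (induction m y q arbitrary: s rule: ladder.induct)
  case (1 m y q)
  show ?case
  proof (cases "m < 2")
    case True
    then show ?thesis by (simp add: ladder.simps[of m])
  next
    case m2: False
    note lay = layoutD[OF "1.prems"]
    let ?y = "\<lambda>j. y (2*j+1)" and ?q = "\<lambda>t. q (Suc t)" and ?h = "m div 2"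
    \<comment> \<open>\<open>e\<close> is the last time of the window of the recursive call; the
      outer down round shares it.\<close>
    define e where "e = s + 1 + (2 * floor_log ?h + 2)"
    have d: "s + (2 * floor_log m + 2) = e + 1" "s + 3 \<le> e"
      using m2 by (auto simp: e_def floor_log_rec[of m] simp del: floor_log_half)
    note half = layout_half[OF "1.prems"]
    obtain xs where xs: "map snd xs = ladder ?h ?y ?q"
      "\<forall>(t, g)\<in>set xs. s + 1 < t \<and> t \<le> e \<and>
        (set (wires g) \<inter> ?y ` {..<?h} \<noteq> {} \<longrightarrow> s + 2 < t \<and> t < e)"
      "sorted_wrt (\<lambda>(t, g) (u, h). set (wires g) \<inter> set (wires h) \<noteq> {} \<longrightarrow> t < u) xs"
      using "1.IH"[OF m2 half, of "s + 1"] unfolding e_def by auto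
    have inner: "set (wires g) \<subseteq> ?y ` {..<?h} \<union> case_prod ?q ` slots ?h" if "(t, g) \<in> set xs" for t g
    proof -
      have "g \<in> set (ladder ?h ?y ?q)"
        using xs(1) that by (metis image_eqI set_map snd_conv)
      then show ?thesis
        using ladder_wires[OF half] by blast
    qed
    have y_q: "y i \<notin> case_prod ?q ` slots ?h" if "i < m" for i
      using that layout_yq[OF "1.prems", of i "Suc _"] by auto
    have q_q: "q 0 i \<notin> case_prod ?q ` slots ?h" if "1 \<le> i" "i < m" for i
      using that layout_q[OF "1.prems", of 0 i "Suc _"] by auto
    define zs where "zs = map (Pair (s + 1)) (prop_round m q) @ map (Pair (s + 2)) (up_round m y q) @
      xs @ map (Pair e) (down_round m y q) @ map (Pair (e + 1)) (prop_round m q)"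
    have "map snd zs = ladder m y q"
      using m2 xs(1) by (simp add: zs_def ladder.simps[of m] comp_def)
    moreover have "s < t \<and> t \<le> e + 1 \<and> (set (wires g) \<inter> y ` {..<m} \<noteq> {} \<longrightarrow> s + 1 < t \<and> t < e + 1)"
      if tg: "(t, g) \<in> set zs" for t g
    proof -
      consider "t = s + 1 \<or> t = e + 1" "g \<in> set (prop_round m q)" | "t = s + 2" | "(t, g) \<in> set xs" | "t = e"
        using tg by (auto simp: zs_def)
      then show ?thesis
      proof cases
        case 1
        then obtain j where "1 \<le> j" "j < ?h" "g = Toffoli (q 0 (2*j)) (q 0 (2*j+1)) (q 1 j)"
          using wires_rounds(1) by blast
        then have "set (wires g) \<inter> y ` {..<m} = {}"
          by (auto simp: lay)
        then show ?thesis using 1 d by auto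
      qed (use d xs(2) in fastforce)+
    qed
    moreover have "sorted_wrt (\<lambda>(t, g) (u, h). set (wires g) \<inter> set (wires h) \<noteq> {} \<longrightarrow> t < u) zs"
    proof -
      let ?R = "\<lambda>(t :: nat, g) (u, h). set (wires g) \<inter> set (wires h) \<noteq> {} \<longrightarrow> t < u"
      have disj: "sorted_wrt ?R (map (Pair t) gs)"
        if "sorted_wrt (\<lambda>g h. set (wires g) \<inter> set (wires h) = {}) gs" for t gs
        using that by (auto simp: sorted_wrt_map elim: sorted_wrt_mono_rel[rotated])
      have P: "sorted_wrt (\<lambda>g h. set (wires g) \<inter> set (wires h) = {}) (prop_round m q)"
        unfolding prop_round_def sorted_wrt_map
        by (rule sorted_wrt_mono_rel[OF _ sorted_wrt_upt]) (auto simp: lay)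
      have U: "sorted_wrt (\<lambda>g h. set (wires g) \<inter> set (wires h) = {}) (up_round m y q)"
        unfolding up_round_def sorted_wrt_map
        by (rule sorted_wrt_mono_rel[OF _ sorted_wrt_upt]) (auto simp: lay)
      have D: "sorted_wrt (\<lambda>g h. set (wires g) \<inter> set (wires h) = {}) (down_round m y q)"
        unfolding down_round_def sorted_wrt_map
        by (rule sorted_wrt_mono_rel[OF _ sorted_wrt_upt]) (auto simp: lay)
      have meets: "A \<inter> Y \<noteq> {}" if "A \<subseteq> Y \<union> Q" "B \<inter> Q = {}" "A \<inter> B \<noteq> {}" for A B Y Q :: "nat set"
        using that by blast
      \<comment> \<open>Up and down rounds use none of the ancillas of the recursive call. A wire
        common with one of its gates is thus an odd position, and such gates are kept off the times
        \<open>s + 2\<close> and \<open>e\<close>.\<close>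
      have in_y: "set (wires g) \<inter> ?y ` {..<?h} \<noteq> {}"
        if xg: "(t, g) \<in> set xs" and h: "h \<in> set (up_round m y q) \<union> set (down_round m y q)"
          and gh: "set (wires g) \<inter> set (wires h) \<noteq> {}" for t g h
      proof -
        have "set (wires h) \<inter> case_prod ?q ` slots ?h = {}"
        proof (cases "h \<in> set (up_round m y q)")
          case True
          then obtain j where "j < ?h" "h = Toffoli (y (2*j)) (q 0 (2*j+1)) (y (2*j+1))"
            using wires_rounds(2) by blast
          then show ?thesis
            using y_q[of "2*j"] y_q[of "2*j+1"] q_q[of "2*j+1"] by simp
        next
          case False
          then obtain j where "j < (m-1) div 2" "h = Toffoli (y (2*j+1)) (q 0 (2*j+2)) (y (2*j+2))"
            using h wires_rounds(3) by blast
          then show ?thesis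
            using y_q[of "2*j+2"] y_q[of "2*j+1"] q_q[of "2*j+2"] by simp
        qed
        then show ?thesis
          by (rule meets[OF inner[OF xg] _ gh])
      qed
      have x_bounds: "s + 1 < t \<and> t \<le> e" if "(t, g) \<in> set xs" for t g
        using bspec[OF xs(2) that] by simp
      have x_late: "s + 2 < t \<and> t < e"
        if "(t, g) \<in> set xs" "set (wires g) \<inter> ?y ` {..<?h} \<noteq> {}" for t g
        using bspec[OF xs(2) that(1)] that(2) by simp
      have up: "s + 2 < t"
        if "(t, g) \<in> set xs" "h \<in> set (up_round m y q)" "set (wires h) \<inter> set (wires g) \<noteq> {}" for t g h
      proof -
        have "set (wires g) \<inter> set (wires h) \<noteq> {}" using that(3) by (simp add: Int_commute)
        from x_late[OF that(1) in_y[OF that(1) UnI1[OF that(2)] this]] show ?thesis by simp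
      qed
      have down: "t < e"
        if "(t, g) \<in> set xs" "h \<in> set (down_round m y q)" "set (wires g) \<inter> set (wires h) \<noteq> {}" for t g h
        using x_late[OF that(1) in_y[OF that(1) UnI2[OF that(2)] that(3)]] by simp
      show ?thesis
        unfolding zs_def sorted_wrt_append
      proof (intro conjI disj[OF P] disj[OF U] disj[OF D] xs(3))
        show "\<forall>a\<in>set (map (Pair (s + 1)) (prop_round m q)).
          \<forall>b\<in>set (map (Pair (s + 2)) (up_round m y q) @ xs @ map (Pair e) (down_round m y q) @
            map (Pair (e + 1)) (prop_round m q)). ?R a b"
          using d(2) by (auto dest: x_bounds)
        show "\<forall>a\<in>set (map (Pair (s + 2)) (up_round m y q)).
          \<forall>b\<in>set (xs @ map (Pair e) (down_round m y q) @ map (Pair (e + 1)) (prop_round m q)). ?R a b"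
          using d(2) by (auto dest: up)
        show "\<forall>a\<in>set xs. \<forall>b\<in>set (map (Pair e) (down_round m y q) @ map (Pair (e + 1)) (prop_round m q)). ?R a b"
          by (auto dest: down x_bounds)
        show "\<forall>a\<in>set (map (Pair e) (down_round m y q)). \<forall>b\<in>set (map (Pair (e + 1)) (prop_round m q)). ?R a b"
          by auto
      qed
    qed
    ultimately show ?thesis
      unfolding d(1) by (intro exI[of _ zs]) blast
  qed
qed

lemma toffoli_depth_ladder:
  assumes "layout m y q"
  shows "toffoli_depth (ladder m y q) \<le> 2 * floor_log m + 2"
proof -
  obtain xs where xs: "map snd xs = ladder m y q"
    "\<forall>(t, g)\<in>set xs. 0 < t \<and> t \<le> 0 + (2 * floor_log m + 2) \<and>
      (set (wires g) \<inter> y ` {..<m} \<noteq> {} \<longrightarrow> 0 + 1 < t \<and> t < 0 + (2 * floor_log m + 2))"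
    "sorted_wrt (\<lambda>(t, g) (u, h). set (wires g) \<inter> set (wires h) \<noteq> {} \<longrightarrow> t < u) xs"
    using ladder_schedule[OF assms, of 0] by (elim exE conjE) (rule that; assumption)
  have "\<forall>(t, g)\<in>set xs. 0 < t \<and> t \<le> 2 * floor_log m + 2"
    using xs(2) by (auto simp del: floor_log_half)
  from toffoli_depth_timed_le[OF this xs(3)] show ?thesis
    by (simp only: xs(1))
qed

text \<open>For \<open>s > 0\<close> the position \<open>2 ^ s - 1\<close> is odd and becomes
  position \<open>2 ^ (s - 1) - 1\<close> of the recursive call. At each of \<open>s\<close> levels
  an up gate writes it and a down gate reads it; the bound on \<open>m\<close> guarantees that the
  down gate exists.\<close>

lemma ladder_touch:
  assumes "2 ^ Suc s \<le> m"
  shows "2 * s \<le> length (filter (\<lambda>g. y (2 ^ s - 1) \<in> set (wires g)) (ladder m y q))"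
  using assms
proof (induction s arbitrary: m y q)
  case (Suc s)
  let ?y = "\<lambda>j. y (2*j+1)" and ?q = "\<lambda>t. q (Suc t)"
  obtain j where j: "(2 :: nat) ^ s = Suc j"
    by (metis not0_implies_Suc power_not_zero zero_neq_numeral)
  let ?P = "\<lambda>g. y (2*j+1) \<in> set (wires g)"
  have w: "2 ^ Suc s - 1 = 2 * j + 1"
    by (simp add: j)
  have m: "\<not> m < 2" "j < m div 2" "j < (m - 1) div 2"
    using Suc.prems by (simp_all add: j)
  have ne: "1 \<le> length (filter Q gs)" if "g \<in> set gs" "Q g" for g :: gate and Q gs
  proof -
    have "g \<in> set (filter Q gs)" using that by simp
    then show ?thesis by (cases "filter Q gs") auto
  qed
  have "Toffoli (y (2*j)) (q 0 (2*j+1)) (y (2*j+1)) \<in> set (up_round m y q)"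
    using m(2) by (auto simp: up_round_def)
  from ne[OF this, of ?P] have U: "1 \<le> length (filter ?P (up_round m y q))"
    by simp
  have "Toffoli (y (2*j+1)) (q 0 (2*j+2)) (y (2*j+2)) \<in> set (down_round m y q)"
    using m(3) by (auto simp: down_round_def)
  from ne[OF this, of ?P] have D: "1 \<le> length (filter ?P (down_round m y q))"
    by simp
  have "2 ^ Suc s \<le> m div 2"
    using Suc.prems by simp
  from Suc.IH[OF this, of ?y ?q] have I: "2 * s \<le> length (filter ?P (ladder (m div 2) ?y ?q))"
    by (simp add: j)
  have E: "length (filter ?P (ladder m y q)) = length (filter ?P (prop_round m q)) +
      length (filter ?P (up_round m y q)) + length (filter ?P (ladder (m div 2) ?y ?q)) +
      length (filter ?P (down_round m y q)) + length (filter ?P (prop_round m q))"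
    using m(1) by (subst ladder.simps) (simp del: One_nat_def)
  have "2 * Suc s \<le> t" if "2 * s \<le> l" "t = p + u + l + d + p'" "1 \<le> u" "1 \<le> d" for t p p' u d l :: nat
    using that by simp
  from this[OF I E U D] show ?case
    unfolding w .
qed simp

section \<open>Counting\<close>

lemma finite_bits: "finite {i. bit (n :: nat) i}"
proof (rule finite_subset)
  show "{i. bit n i} \<subseteq> {..n}"
  proof (intro subsetI, rule ccontr)
    fix i assume "i \<in> {i. bit n i}" "i \<notin> {..n}"
    moreover from this have "n < 2 ^ i"
      by (meson atMost_iff less_exp less_trans not_le)
    ultimately show False by (simp add: bit_iff_odd)
  qed
qed simp

lemma hamming_weight_rec: "hamming_weight n = n mod 2 + hamming_weight (n div 2)"
proof -
  have "{i. bit n i} = (if odd n then {0} else {}) \<union> Suc ` {i. bit (n div 2) i}"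
  proof (rule set_eqI)
    fix i show "i \<in> {i. bit n i} \<longleftrightarrow> i \<in> (if odd n then {0} else {}) \<union> Suc ` {i. bit (n div 2) i}"
      by (cases i) (auto simp: bit_0 bit_Suc)
  qed
  then have "hamming_weight n = card ((if odd n then {0} else {}) \<union> Suc ` {i. bit (n div 2) i})"
    by (simp add: hamming_weight_def)
  also have "\<dots> = card (if odd n then {0 :: nat} else {}) + card (Suc ` {i. bit (n div 2) i})"
    by (rule card_Un_disjoint) (auto simp: finite_bits)
  finally show ?thesis
    by (auto simp: hamming_weight_def card_image mod_2_eq_odd)
qed

lemma hamming_weight_0 [simp]: "hamming_weight 0 = 0"
  by (simp add: hamming_weight_def)

lemma hamming_weight_1 [simp]: "hamming_weight (Suc 0) = Suc 0"
  by (subst hamming_weight_rec) simp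

text \<open>Keeps the Hamming weights in the gate count within logarithmic order.\<close>

lemma hamming_weight_bounds: "n > 0 \<Longrightarrow> 1 \<le> hamming_weight n \<and> hamming_weight n \<le> floor_log n + 1"
proof (induction n rule: floor_log_induct)
  case one
  then show ?case by simp
next
  case (double n)
  then show ?case
    using hamming_weight_rec[of n] by (auto simp: floor_log_rec[of n] simp del: floor_log_half)
qed

section \<open>Numbers of ancillas and of gates in a ladder\<close>

lemma slots_rec: "slots m = Pair 0 ` {1..<m} \<union> (\<lambda>(t, j). (Suc t, j)) ` slots (m div 2)"
proof (rule set_eqI)
  fix p show "p \<in> slots m \<longleftrightarrow> p \<in> Pair 0 ` {1..<m} \<union> (\<lambda>(t, j). (Suc t, j)) ` slots (m div 2)"
    by (cases p; cases "fst p") force+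
qed

lemma slots_0_empty [simp]: "slots 0 = {}"
  by (auto simp: slots_def)

lemma finite_slots [simp]: "finite (slots m)"
proof (induction m rule: less_induct)
  case (less m)
  then show ?case
    by (cases "m = 0") (simp_all add: slots_rec[of m])
qed

lemma card_slots: "card (slots m) = (m - 1) + card (slots (m div 2))"
proof -
  have "card (slots m) = card (Pair (0::nat) ` {1..<m}) + card ((\<lambda>(t, j). (Suc t, j)) ` slots (m div 2))"
    by (subst slots_rec, rule card_Un_disjoint) auto
  moreover have "inj_on (\<lambda>(t, j). (Suc t, j)) (slots (m div 2))"
    by (auto simp: inj_on_def)
  ultimately show ?thesis
    by (simp add: card_image inj_on_def[of "Pair 0"])
qed

text \<open>Level 0 lives in the second register, so this counts the ancillas. Level
  \<open>t\<close> \<ge> 1 needs \<open>n div 2 ^ t - 1\<close> of them; by Legendre's formula the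
  quotients add up to \<open>n - hamming_weight n\<close>, and there are \<open>floor_log n\<close>
  levels.\<close>

lemma card_slots_half: "n > 0 \<Longrightarrow> card (slots (n div 2)) + hamming_weight n + floor_log n = n"
proof (induction n rule: floor_log_induct)
  case one
  then show ?case by simp
next
  case (double n)
  have "n = 2 * (n div 2) + n mod 2" "1 \<le> n div 2"
    using double.hyps by auto
  then show ?case
    using double.IH hamming_weight_rec[of n] card_slots[of "n div 2"] floor_log_rec[OF double.hyps]
    by linarith
qed

text \<open>With \<open>h = n div 2\<close>, the four rounds of one level have
  \<open>4 * h - 3 + n mod 2\<close> gates. Over all levels the halves sum to
  \<open>n - hamming_weight n\<close>, and the parities count every one bit but the leading
  one.\<close>

lemma length_ladder:
  "n > 0 \<Longrightarrow> length (ladder n y q) + 3 * hamming_weight n + 3 * floor_log n + 1 = 4 * n"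
proof (induction n arbitrary: y q rule: floor_log_induct)
  case one
  then show ?case by (simp add: ladder.simps[of "Suc 0"])
next
  case (double n)
  let ?l = "length (ladder (n div 2) (\<lambda>j. y (2*j+1)) (\<lambda>t. q (Suc t)))"
  have "length (ladder n y q) = (n div 2 - 1) + n div 2 + ?l + (n - 1) div 2 + (n div 2 - 1)"
    using double.hyps by (simp add: ladder.simps[of n] prop_round_def up_round_def down_round_def add_ac)
  moreover have "n = 2 * (n div 2) + n mod 2" "1 \<le> n div 2" "(n - 1) div 2 + 1 = n div 2 + n mod 2"
    using double.hyps by (simp_all, presburger)
  ultimately show ?case
    using double.IH[of "\<lambda>j. y (2*j+1)" "\<lambda>t. q (Suc t)"] hamming_weight_rec[of n]
      floor_log_rec[OF double.hyps] by linarith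
qed

section \<open>The adder\<close>

primrec carry :: "nat \<Rightarrow> nat \<Rightarrow> nat \<Rightarrow> bool" where
  "carry a b 0 = False"
| "carry a b (Suc i) = ((bit a i \<and> bit b i) \<or> (carry a b i \<and> (bit a i \<or> bit b i)))"

text \<open>The carry is exactly what shifting the summands separately loses; comparing parities
  then gives \<open>bit_add\<close>.\<close>

lemma add_div_carry:
  "(a + b) div 2 ^ i = a div 2 ^ i + b div 2 ^ i + of_bool (carry a b i)"
proof (induction i)
  case (Suc i)
  have half: "m div 2 ^ Suc i = m div 2 ^ i div 2" for m :: nat
    by (simp add: div_mult2_eq[symmetric] mult.commute)
  have "(u + v + of_bool c) div 2 = u div 2 + v div 2 + of_bool ((odd u \<and> odd v) \<or> (c \<and> (odd u \<or> odd v)))"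
    for u v :: nat and c
    by (cases c; simp; presburger)
  then show ?case
    by (simp add: half Suc bit_iff_odd del: power_Suc)
qed simp

lemma bit_add: "bit (a + b) i \<longleftrightarrow> (bit a i \<noteq> (bit b i \<noteq> carry a b i))" for a b :: nat
  by (auto simp: bit_iff_odd add_div_carry)

text \<open>Position \<open>i\<close> of the ladder belongs to the carry of index
  \<open>i + 1\<close>, which is added to the bit of \<open>a\<close> of that index; the final carry
  goes to the wire of \<open>z\<close>.\<close>

definition carry_wire :: "nat \<Rightarrow> nat \<Rightarrow> nat" where
  "carry_wire n i = (if i + 1 < n then i + 1 else 2*n)"

text \<open>Adds the term \<open>a i\<close> of the carry recurrence to the wire of the next carry.
  Descending order lets every gate read an unmodified bit of \<open>a\<close>.\<close>

definition chain :: "nat \<Rightarrow> nat \<Rightarrow> gate list" where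
  "chain n m = map (\<lambda>i. CNOT i (carry_wire n i)) (rev [1..<m])"

text \<open>As \<open>c 0\<close> vanishes, the first carry is \<open>a 0 \<cdot> b 0\<close>. It
  needs \<open>b 0\<close> itself, which is why the first \<open>xor_block\<close> of the adder
  starts at index 1.\<close>

definition carry_block :: "nat \<Rightarrow> (nat \<Rightarrow> nat \<Rightarrow> nat) \<Rightarrow> nat \<Rightarrow> gate list" where
  "carry_block n q m = (if m = 0 then [] else
     chain n m @ Toffoli 0 n (carry_wire n 0) # ladder m (carry_wire n) q)"

definition xor_block :: "nat \<Rightarrow> nat \<Rightarrow> gate list" where
  "xor_block n l = map (\<lambda>i. CNOT i (n + i)) [l..<n]"

definition neg_block :: "nat \<Rightarrow> gate list" where
  "neg_block n = map (\<lambda>i. X (n + i)) [1..<n]"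

text \<open>Write \<open>p i\<close> for \<open>a i \<oplus> b i\<close>. The first block turns the wires \<open>a i\<close> into \<open>s i = a i \<oplus> c i\<close>,
  with multipliers \<open>p i\<close>. To undo this after the sum bits \<open>p i \<oplus> s i\<close> have replaced the \<open>p i\<close>, the
  multipliers need not be restored: \<open>p i \<cdot> s i = \<not> (p i \<oplus> s i) \<cdot> s i\<close>, so the negated sum bits
  serve as well. The final carry must stay, hence the second block is one shorter.\<close>

definition adder :: "nat \<Rightarrow> (nat \<Rightarrow> nat \<Rightarrow> nat) \<Rightarrow> gate list" where
  "adder n q = xor_block n 1 @ carry_block n q n @ xor_block n 1 @ neg_block n @
     rev (carry_block n q (n - 1)) @ neg_block n @ xor_block n 0"

text \<open>The multipliers themselves sit in the second register. Level \<open>Suc u\<close> is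
  looked up as level \<open>u\<close> because \<open>e\<close> will number the slots of the halved
  problem.\<close>

definition multiplier_wire :: "nat \<Rightarrow> (nat \<times> nat \<Rightarrow> nat) \<Rightarrow> nat \<Rightarrow> nat \<Rightarrow> nat" where
  "multiplier_wire n e t j = (case t of 0 \<Rightarrow> n + j | Suc u \<Rightarrow> 2*n + 1 + e (u, j))"

definition assign :: "nat \<Rightarrow> (nat \<Rightarrow> bool) \<Rightarrow> (nat \<Rightarrow> bool) \<Rightarrow> bool \<Rightarrow> nat \<Rightarrow> bool" where
  "assign n A B z w = (if w < n then A w else if w < 2*n then B (w - n) else w = 2*n \<and> z)"

lemma assign_simps [simp]:
  "i < n \<Longrightarrow> assign n A B z i = A i"
  "i < n \<Longrightarrow> assign n A B z (n + i) = B i"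
  "assign n A B z (2*n) = z"
  "2*n < w \<Longrightarrow> \<not> assign n A B z w"
  by (auto simp: assign_def)

lemma assign_cong:
  "(\<And>i. i < n \<Longrightarrow> A i = A' i) \<Longrightarrow> (\<And>i. i < n \<Longrightarrow> B i = B' i) \<Longrightarrow> z = z' \<Longrightarrow>
    assign n A B z = assign n A' B' z'"
  by (auto simp: assign_def fun_eq_iff)

lemma slots_mono: "m \<le> n \<Longrightarrow> slots m \<subseteq> slots n"
  by (auto simp: slots_def)

locale adder_layout =
  fixes n k :: nat and e :: "nat \<times> nat \<Rightarrow> nat"
  assumes n: "n \<ge> 1" and e: "bij_betw e (slots (n div 2)) {..<k}"
begin

abbreviation q :: "nat \<Rightarrow> nat \<Rightarrow> nat" where
  "q \<equiv> multiplier_wire n e"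

abbreviation y :: "nat \<Rightarrow> nat" where
  "y \<equiv> carry_wire n"

lemma q_0 [simp]: "q 0 j = n + j" and q_Suc [simp]: "q (Suc t) j = 2*n + 1 + e (t, j)"
  by (simp_all add: multiplier_wire_def)

lemma y_inj: "i < n \<Longrightarrow> j < n \<Longrightarrow> y i = y j \<longleftrightarrow> i = j"
  by (auto simp: carry_wire_def)

lemma y_wire: "y i = i + 1 \<and> i + 1 < n \<or> y i = 2*n \<and> n \<le> i + 1"
  by (auto simp: carry_wire_def)

lemma e_less: "(t, j) \<in> slots (n div 2) \<Longrightarrow> e (t, j) < k"
  using e by (auto simp: bij_betw_def)

lemma q_bound: "(t, j) \<in> slots n \<Longrightarrow> q t j < 2*n + 1 + k"
  by (cases t) (auto simp: e_less)

lemma layout: "m \<le> n \<Longrightarrow> layout m y q"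
proof -
  assume m: "m \<le> n"
  have "inj_on (case_prod q) (slots n)"
  proof (rule inj_onI, clarify)
    fix t i u j assume a: "(t, i) \<in> slots n" "(u, j) \<in> slots n" "q t i = q u j"
    show "t = u \<and> i = j"
    proof (cases t; cases u)
      fix t' u' assume tu: "t = Suc t'" "u = Suc u'"
      then have "(t', i) = (u', j)"
        using a by (intro inj_onD[OF bij_betw_imp_inj_on[OF e]]) auto
      then show ?thesis using tu by simp
    qed (use a in auto)
  qed
  then have "inj_on (case_prod q) (slots m)"
    using slots_mono[OF m] by (rule inj_on_subset)
  moreover have "y i \<noteq> q t j" if "i < m" "(t, j) \<in> slots m" for i t j
    using that m y_wire[of i] by (cases t) auto
  then have "y ` {..<m} \<inter> case_prod q ` slots m = {}"
    by auto
  moreover have "inj_on y {..<m}"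
    using m y_inj by (auto simp: inj_on_def)
  ultimately show ?thesis
    unfolding layout_def by blast
qed

lemma valid_ladder:
  assumes "m \<le> n" "g \<in> set (ladder m y q)"
  shows "valid_gate (2*n + 1 + k) g"
proof -
  have "y ` {..<m} \<subseteq> {..<2*n + 1 + k}"
    using y_wire by (fastforce simp: carry_wire_def)
  moreover have "case_prod q ` slots m \<subseteq> {..<2*n + 1 + k}"
    using slots_mono[OF assms(1)] q_bound by fastforce
  ultimately show ?thesis
    using ladder_wires[OF layout[OF assms(1)] assms(2)] unfolding valid_gate_def by blast
qed

lemma valid_carry_block:
  assumes "m \<le> n" "g \<in> set (carry_block n q m)"
  shows "valid_gate (2*n + 1 + k) g"
proof -
  consider "g \<in> set (chain n m)" | "g = Toffoli 0 n (y 0)" | "g \<in> set (ladder m y q)"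
    using assms(2) by (auto simp: carry_block_def split: if_splits)
  then show ?thesis
  proof cases
    case 1
    then show ?thesis
      using assms(1) by (auto simp: chain_def valid_gate_def carry_wire_def split: if_splits)
  next
    case 2
    then show ?thesis
      using n by (auto simp: valid_gate_def carry_wire_def)
  next
    case 3
    then show ?thesis
      using valid_ladder[OF assms(1)] by blast
  qed
qed

lemma valid_adder: "g \<in> set (adder n q) \<Longrightarrow> valid_gate (2*n + 1 + k) g"
  using valid_carry_block[of n g] valid_carry_block[of "n - 1" g]
  by (auto simp: adder_def xor_block_def neg_block_def valid_gate_def)

lemma run_chain:
  assumes "m \<le> n"
  shows "1 \<le> i \<Longrightarrow> i < m \<Longrightarrow> run (chain n m) f (y i) = (f (y i) \<noteq> f i)"
    and "w \<notin> y ` {1..<m} \<Longrightarrow> run (chain n m) f w = f w"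
proof -
  have "sorted_wrt (\<lambda>i j. j < i) (rev [1..<m])"
    by (simp add: sorted_wrt_rev)
  then have s: "sorted_wrt (\<lambda>g h. target g \<notin> set (wires h)) (chain n m)"
    unfolding chain_def sorted_wrt_map
    by (rule sorted_wrt_mono_rel[rotated]) (use assms in \<open>auto simp: carry_wire_def split: if_splits\<close>)
  show "run (chain n m) f (y i) = (f (y i) \<noteq> f i)" if "1 \<le> i" "i < m"
    using run_target[OF s, of "CNOT i (y i)" f] that by (auto simp: chain_def)
  show "run (chain n m) f w = f w" if "w \<notin> y ` {1..<m}"
    using that by (intro run_other) (auto simp: chain_def)
qed

text \<open>Only the recurrence of \<open>c\<close> matters, not where \<open>B\<close> comes from.
  This admits both uses: \<open>B i = p i\<close> when computing the carries, and the negation of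
  \<open>p i \<oplus> s i\<close> when uncomputing them.\<close>

lemma run_carry_block:
  assumes m: "m \<le> n"
    and c: "(A 0 \<and> B 0) = c 1" "\<And>i. 1 \<le> i \<Longrightarrow> i < m \<Longrightarrow> (A i \<noteq> (B i \<and> (A i \<noteq> c i))) = c (i + 1)"
  shows "run (carry_block n q m) (assign n A B z) =
    assign n (\<lambda>i. if 1 \<le> i \<and> i \<le> m then A i \<noteq> c i else A i) B (if m = n then z \<noteq> c n else z)"
proof (cases "m = 0")
  case True
  then show ?thesis
    using n by (auto simp: carry_block_def intro!: assign_cong)
next
  case False
  let ?f = "assign n A B z"
  define f1 where "f1 = run (chain n m) ?f"
  define f2 where "f2 = act (Toffoli 0 n (y 0)) f1"
  have f1: "f1 (y i) = (?f (y i) \<noteq> A i)" if "1 \<le> i" "i < m" for i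
    using run_chain(1)[OF m that] that m by (simp add: f1_def)
  have f1': "f1 w = ?f w" if "w \<notin> y ` {1..<m}" for w
    using run_chain(2)[OF m that] by (simp add: f1_def)
  have low: "w \<notin> y ` {1..<m}" if w: "w \<le> 1 \<or> n \<le> w" "w \<noteq> 2*n" for w
  proof
    assume "w \<in> y ` {1..<m}"
    then obtain i where "1 \<le> i" "w = y i" by auto
    then show False using w y_wire[of i] by auto
  qed
  have "y 0 \<notin> y ` {1..<m}"
    using m False y_inj by auto
  \<comment> \<open>The chain leaves the wires \<open>0\<close> and \<open>n\<close> alone, so the
    Toffoli gate multiplies the original bits.\<close>
  then have f2_0: "f2 (y 0) = (?f (y 0) \<noteq> c 1)"
    using f1'[of "y 0"] f1'[of 0] f1'[of n] low[of 0] low[of n] assign_simps(2)[of 0 n] n c(1)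
    by (auto simp: f2_def)
  have f2': "f2 w = ?f w" if "w \<notin> y ` {..<m}" for w
  proof -
    have "w \<notin> y ` {1..<m}" "w \<noteq> y 0" using that False by auto
    then show ?thesis using f1' by (simp add: f2_def)
  qed
  have f2: "f2 (y i) = (?f (y i) \<noteq> A i)" if "1 \<le> i" "i < m" for i
    using f1[OF that] y_inj[of i 0] that m n by (simp add: f2_def)
  have B: "f2 (n + i) = B i" if "1 \<le> i" "i < m" for i
  proof -
    have "n + i \<noteq> y j" for j
      using y_wire[of j] that m by auto
    then have "n + i \<notin> y ` {..<m}" by auto
    then show ?thesis using f2' that m by simp
  qed
  have anc: "\<not> f2 (q (Suc t) j)" for t j
  proof -
    have "q (Suc t) j \<noteq> y i" for i
      using y_wire[of i] by auto
    then have "q (Suc t) j \<notin> y ` {..<m}" by blast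
    then have "f2 (q (Suc t) j) = ?f (q (Suc t) j)" by (rule f2')
    then show ?thesis by simp
  qed
  \<comment> \<open>By the recurrence \<open>c(2)\<close>, the term put in by the chain completes
    the product of the ladder to the next carry.\<close>
  have S: "ladder_value (f2 \<circ> y) (f2 \<circ> q 0) i = (?f (y i) \<noteq> c (i + 1))" if "i < m" for i
    using that
  proof (induction i)
    case 0
    then show ?case using f2_0 by simp
  next
    case (Suc i)
    have "?f (y i) = A (i + 1)"
      using Suc.prems m by (simp add: carry_wire_def)
    then show ?case
      using Suc f2[of "Suc i"] B[of "Suc i"] c(2)[of "Suc i"] by auto
  qed
  have run: "run (carry_block n q m) ?f = run (ladder m y q) f2"
    using False by (simp add: carry_block_def f2_def f1_def)
  have RL: "(\<forall>i<m. run (ladder m y q) f2 (y i) = ladder_value (f2 \<circ> y) (f2 \<circ> q 0) i) \<and>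
      (\<forall>w. w \<notin> y ` {..<m} \<longrightarrow> run (ladder m y q) f2 w = f2 w)"
    by (rule run_ladder[OF layout[OF m]]) (rule anc)
  have ly: "run (ladder m y q) f2 (y i) = (?f (y i) \<noteq> c (i + 1))" if "i < m" for i
    using conjunct1[OF RL, rule_format, of i] S[OF that] that by (simp only:)
  have lo: "run (ladder m y q) f2 w = ?f w" if "w \<notin> y ` {..<m}" for w
    using conjunct2[OF RL, rule_format, of w] f2'[OF that] that by (simp only: if_True simp_thms)
  show ?thesis
  proof
    fix w
    show "run (carry_block n q m) ?f w = assign n (\<lambda>i. if 1 \<le> i \<and> i \<le> m then A i \<noteq> c i else A i) B
      (if m = n then z \<noteq> c n else z) w"
    proof (cases "w \<in> y ` {..<m}")
      case True
      then obtain i where i: "i < m" "w = y i" by auto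
      \<comment> \<open>The wire of \<open>z\<close> is reached only by a block of full
        length.\<close>
      have "y i = i + 1 \<and> i + 1 < n \<or> y i = 2*n \<and> i + 1 = n \<and> m = n"
        using y_wire[of i] i(1) m by auto
      then show ?thesis
        using ly[OF i(1)] i unfolding run by (auto simp: assign_def)
    next
      case no: False
      have "\<not> (1 \<le> w \<and> w \<le> m \<and> w < n)"
      proof
        assume w: "1 \<le> w \<and> w \<le> m \<and> w < n"
        then have "w = y (w - 1)" "w - 1 < m" by (auto simp: carry_wire_def)
        then show False using no by blast
      qed
      moreover have "w \<noteq> 2*n" if "m = n"
      proof
        assume "w = 2*n"
        then have "w = y (n - 1)" "n - 1 < m" using that n by (auto simp: carry_wire_def)
        then show False using no by blast
      qed
      ultimately show ?thesis
        using lo[OF no] unfolding run by (auto simp: assign_def)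
    qed
  qed
qed

lemma run_xor_block:
  "run (xor_block n l) (assign n A B z) = assign n A (\<lambda>i. if l \<le> i then B i \<noteq> A i else B i) z"
proof
  fix w
  have s: "sorted_wrt (\<lambda>g h. target g \<notin> set (wires h)) (xor_block n l)"
    unfolding xor_block_def sorted_wrt_map
    by (rule sorted_wrt_mono_rel[OF _ sorted_wrt_upt]) auto
  show "run (xor_block n l) (assign n A B z) w = assign n A (\<lambda>i. if l \<le> i then B i \<noteq> A i else B i) z w"
  proof (cases "\<exists>i. l \<le> i \<and> i < n \<and> w = n + i")
    case True
    then obtain i where "l \<le> i" "i < n" "w = n + i" by blast
    then show ?thesis
      using run_target[OF s, of "CNOT i (n + i)"] by (simp add: xor_block_def)
  next
    case False
    then have "run (xor_block n l) (assign n A B z) w = assign n A B z w"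
      by (intro run_other) (auto simp: xor_block_def)
    moreover have "\<not> (n \<le> w \<and> w < 2*n \<and> l \<le> w - n)"
    proof
      assume "n \<le> w \<and> w < 2*n \<and> l \<le> w - n"
      then have "l \<le> w - n \<and> w - n < n \<and> w = n + (w - n)" by auto
      with False show False by blast
    qed
    ultimately show ?thesis
      by (auto simp: assign_def)
  qed
qed

lemma run_neg_block:
  "run (neg_block n) (assign n A B z) = assign n A (\<lambda>i. if 1 \<le> i then \<not> B i else B i) z"
proof
  fix w
  have s: "sorted_wrt (\<lambda>g h. target g \<notin> set (wires h)) (neg_block n)"
    unfolding neg_block_def sorted_wrt_map
    by (rule sorted_wrt_mono_rel[OF _ sorted_wrt_upt]) auto
  show "run (neg_block n) (assign n A B z) w = assign n A (\<lambda>i. if 1 \<le> i then \<not> B i else B i) z w"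
  proof (cases "\<exists>i. 1 \<le> i \<and> i < n \<and> w = n + i")
    case True
    then obtain i where "1 \<le> i" "i < n" "w = n + i" by blast
    then show ?thesis
      using run_target[OF s, of "X (n + i)"] by (simp add: neg_block_def)
  next
    case False
    then have "run (neg_block n) (assign n A B z) w = assign n A B z w"
      by (intro run_other) (auto simp: neg_block_def)
    moreover have "\<not> (n \<le> w \<and> w < 2*n \<and> 1 \<le> w - n)"
    proof
      assume "n \<le> w \<and> w < 2*n \<and> 1 \<le> w - n"
      then have "1 \<le> w - n \<and> w - n < n \<and> w = n + (w - n)" by auto
      with False show False by blast
    qed
    ultimately show ?thesis
      by (auto simp: assign_def)
  qed
qed

lemma run_adder:
  "run (adder n q) (assign n (bit a) (bit b) z) = assign n (bit a) (bit (a + b)) (z \<noteq> carry a b n)"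
proof -
  let ?c = "carry a b"
  let ?z = "z \<noteq> ?c n"
  \<comment> \<open>From index 1 on, \<open>?B1\<close> is \<open>p i\<close>, \<open>?A2\<close> is
    \<open>s i\<close>, and \<open>?B3\<close> is
    \<open>p i \<oplus> s i = b i \<oplus> c i\<close>.\<close>
  let ?B1 = "\<lambda>i. if 1 \<le> i then bit b i \<noteq> bit a i else bit b i"
  let ?A2 = "\<lambda>i. bit a i \<noteq> ?c i"
  let ?B3 = "\<lambda>i. if 1 \<le> i then bit b i \<noteq> ?c i else bit b i"
  let ?B4 = "\<lambda>i. if 1 \<le> i then \<not> (bit b i \<noteq> ?c i) else bit b i"
  let ?f0 = "assign n (bit a) (bit b) z"
  have 1: "run (xor_block n 1) ?f0 = assign n (bit a) ?B1 z"
    by (rule run_xor_block)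
  have 2: "run (carry_block n q n) (assign n (bit a) ?B1 z) = assign n ?A2 ?B1 ?z"
  proof -
    have "run (carry_block n q n) (assign n (bit a) ?B1 z)
        = assign n (\<lambda>i. if 1 \<le> i \<and> i \<le> n then bit a i \<noteq> ?c i else bit a i) ?B1 (if n = n then z \<noteq> ?c n else z)"
      by (rule run_carry_block) auto
    also have "\<dots> = assign n ?A2 ?B1 ?z"
      by (rule assign_cong) (auto simp: Suc_le_eq)
    finally show ?thesis .
  qed
  have 3: "run (xor_block n 1) (assign n ?A2 ?B1 ?z) = assign n ?A2 ?B3 ?z"
    unfolding run_xor_block by (rule assign_cong) auto
  have 4: "run (neg_block n) (assign n ?A2 ?B3 ?z) = assign n ?A2 ?B4 ?z"
    unfolding run_neg_block by (rule assign_cong) auto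
  \<comment> \<open>The uncomputation read backwards: started on the restored \<open>a\<close> with
    multipliers \<open>?B4\<close>, the block must produce the present state.\<close>
  have "run (carry_block n q (n - 1)) (assign n (bit a) ?B4 ?z) = assign n ?A2 ?B4 ?z"
  proof -
    have "run (carry_block n q (n - 1)) (assign n (bit a) ?B4 ?z)
        = assign n (\<lambda>i. if 1 \<le> i \<and> i \<le> n - 1 then bit a i \<noteq> ?c i else bit a i) ?B4
            (if n - 1 = n then ?z \<noteq> ?c n else ?z)"
      by (rule run_carry_block) auto
    also have "\<dots> = assign n ?A2 ?B4 ?z"
      using n by (intro assign_cong) (auto simp: Suc_le_eq)
    finally show ?thesis .
  qed
  then have 5: "run (rev (carry_block n q (n - 1))) (assign n ?A2 ?B4 ?z) = assign n (bit a) ?B4 ?z"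
    using run_rev[of "carry_block n q (n - 1)" "assign n (bit a) ?B4 ?z"] valid_carry_block[of "n - 1"]
    by (simp add: valid_gate_def)
  have 6: "run (neg_block n) (assign n (bit a) ?B4 ?z) = assign n (bit a) ?B3 ?z"
    unfolding run_neg_block by (rule assign_cong) auto
  \<comment> \<open>Only now is \<open>a i\<close> added to \<open>b i \<oplus> c i\<close>; index
    0, skipped so far, becomes \<open>a 0 \<oplus> b 0\<close>, its carry being zero.\<close>
  have 7: "run (xor_block n 0) (assign n (bit a) ?B3 ?z) = assign n (bit a) (bit (a + b)) ?z"
    unfolding run_xor_block by (rule assign_cong) (auto simp: bit_add Suc_le_eq)
  show ?thesis
    unfolding adder_def fold_append o_apply 1 2 3 4 5 6 7 ..
qed

lemma registers:
  "reg n a @ reg n b @ [z] @ replicate k False = map (assign n (bit a) (bit b) z) [0..<2*n + 1 + k]"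
proof (rule nth_equalityI)
  fix i assume "i < length (reg n a @ reg n b @ [z] @ replicate k False)"
  then have "i < 2*n + 1 + k" by simp
  then show "(reg n a @ reg n b @ [z] @ replicate k False) ! i = map (assign n (bit a) (bit b) z) [0..<2*n + 1 + k] ! i"
    by (auto simp: nth_append reg_def assign_def nth_Cons' simp del: upt_Suc)
qed simp

lemma reg_mod: "reg n (x mod 2 ^ n) = reg n x"
  by (simp add: reg_def bit_take_bit_iff flip: take_bit_eq_mod)

theorem adder_implements: "implements_add n k (adder n q)"
proof (rule implements_addI)
  show "\<forall>g\<in>set (adder n q). valid_gate (2*n + 1 + k) g"
    using valid_adder by blast
next
  fix a b :: nat and z assume "a < 2 ^ n" "b < 2 ^ n"
  then have "\<not> bit a n" "\<not> bit b n"
    by (simp_all add: bit_iff_odd)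
  then have "bit (a + b) n = carry a b n"
    by (simp add: bit_add)
  then have "fold gate_map (adder n q) (reg n a @ reg n b @ [z] @ replicate k False)
      = map (assign n (bit a) (bit (a + b)) (z \<noteq> bit (a + b) n)) [0..<2*n + 1 + k]"
    unfolding registers using valid_adder by (subst map_run) (auto simp: run_adder)
  then show "fold gate_map (adder n q) (reg n a @ reg n b @ [z] @ replicate k False)
      = reg n a @ reg n ((a + b) mod 2 ^ n) @ [z \<noteq> bit (a + b) n] @ replicate k False"
    unfolding reg_mod registers[symmetric] .
qed

section \<open>Gate count and depth of the adder\<close>

lemma ladder_Toffoli: "m \<le> n \<Longrightarrow> \<forall>g\<in>set (ladder m y q). is_Toffoli g"
  using ladder_wires[OF layout] by blast

lemma free_of_Toffoli:
  "\<forall>g\<in>set (chain n m). \<not> is_Toffoli g" "\<forall>g\<in>set (xor_block n l). \<not> is_Toffoli g"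
  "\<forall>g\<in>set (neg_block n). \<not> is_Toffoli g"
  by (auto simp: chain_def xor_block_def neg_block_def)

lemma count_carry_block:
  "m \<le> n \<Longrightarrow> toffoli_count (carry_block n q m) = (if m = 0 then 0 else 1 + length (ladder m y q))"
  using ladder_Toffoli[of m] free_of_Toffoli(1)[of m]
  by (simp add: toffoli_count_def carry_block_def filter_empty_conv filter_id_conv)

text \<open>Two blocks, of lengths \<open>n\<close> and \<open>n - 1\<close>, each with one Toffoli
  gate besides its ladder.\<close>

lemma count_adder:
  assumes "n \<ge> 2"
  shows "toffoli_count (adder n q) + 4 + 3 * (hamming_weight n + floor_log n +
    hamming_weight (n - 1) + floor_log (n - 1)) = 8 * n"
proof -
  have "toffoli_count (adder n q) = toffoli_count (carry_block n q n) + toffoli_count (carry_block n q (n - 1))"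
    using free_of_Toffoli(2)[of 0] free_of_Toffoli(2)[of 1] free_of_Toffoli(3)
    by (simp add: adder_def toffoli_count_def rev_filter[symmetric] filter_empty_conv flip: filter_empty_conv)
  also have "\<dots> = 2 + length (ladder n y q) + length (ladder (n - 1) y q)"
    using assms by (simp add: count_carry_block)
  finally show ?thesis
    using length_ladder[of n y q] length_ladder[of "n - 1" y q] assms by simp
qed

lemma depth_carry_block:
  assumes "m \<le> n"
  shows "toffoli_depth (carry_block n q m) \<le> 2 * floor_log m + 3"
    and "toffoli_depth (rev (carry_block n q m)) \<le> 2 * floor_log m + 3"
proof -
  let ?T = "[Toffoli 0 n (y 0)]"
  have L: "toffoli_depth (ladder m y q) \<le> 2 * floor_log m + 2"
    by (rule toffoli_depth_ladder[OF layout[OF assms]])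
  have R: "toffoli_depth (rev (ladder m y q)) \<le> 2 * floor_log m + 2"
    using toffoli_depth_rev_le[OF ladder_Toffoli[OF assms]] L by simp
  have C: "toffoli_depth (chain n m) = 0" "toffoli_depth (rev (chain n m)) = 0"
    using free_of_Toffoli(1) by (auto intro!: toffoli_depth_no_Toffoli)
  have T: "toffoli_depth ?T \<le> 1"
    using toffoli_depth_le_length[of ?T] by simp
  have N: "toffoli_depth [] = 0"
    by (simp add: toffoli_depth_no_Toffoli)
  have eq: "carry_block n q m = (if m = 0 then [] else chain n m @ (?T @ ladder m y q))"
    "rev (carry_block n q m) = (if m = 0 then [] else (rev (ladder m y q) @ ?T) @ rev (chain n m))"
    by (simp_all add: carry_block_def)
  show "toffoli_depth (carry_block n q m) \<le> 2 * floor_log m + 3"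
    using toffoli_depth_append[of "chain n m" "?T @ ladder m y q"]
      toffoli_depth_append[of ?T "ladder m y q"] L C T N unfolding eq(1) by auto
  show "toffoli_depth (rev (carry_block n q m)) \<le> 2 * floor_log m + 3"
    using toffoli_depth_append[of "rev (ladder m y q) @ ?T" "rev (chain n m)"]
      toffoli_depth_append[of "rev (ladder m y q)" ?T] R C T N unfolding eq(2) by auto
qed

text \<open>Blocks of CNOT and X gates have depth zero, so by subadditivity only the two carry
  blocks count.\<close>

lemma depth_adder_le: "toffoli_depth (adder n q) \<le> 4 * floor_log n + 6"
proof -
  have Z: "toffoli_depth (xor_block n l) = 0" "toffoli_depth (neg_block n) = 0" for l
    using free_of_Toffoli by (auto intro!: toffoli_depth_no_Toffoli)
  have "floor_log (n - 1) \<le> floor_log n"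
    by (rule floor_log_le_iff) simp
  moreover have "toffoli_depth (adder n q)
      \<le> toffoli_depth (carry_block n q n) + toffoli_depth (rev (carry_block n q (n - 1)))"
  proof -
    have L: "toffoli_depth (xs @ ys) \<le> toffoli_depth ys" if "toffoli_depth xs = 0" for xs ys
      using toffoli_depth_append[of xs ys] that by simp
    have R: "toffoli_depth (xs @ ys) \<le> toffoli_depth xs + d" if "toffoli_depth ys \<le> d" for xs ys d
      using toffoli_depth_append[of xs ys] that by simp
    have "toffoli_depth (rev (carry_block n q (n - 1)) @ neg_block n @ xor_block n 0)
        \<le> toffoli_depth (rev (carry_block n q (n - 1))) + 0"
      by (intro R order_trans[OF L]) (simp_all add: Z)
    then have "toffoli_depth (xor_block n 1 @ neg_block n @ rev (carry_block n q (n - 1)) @ neg_block n @ xor_block n 0)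
        \<le> toffoli_depth (rev (carry_block n q (n - 1)))"
      using order_trans[OF L[OF Z(1)] L[OF Z(2)]] order_trans by fastforce
    from order_trans[OF L[OF Z(1)] R[OF this]] show ?thesis
      unfolding adder_def .
  qed
  ultimately show ?thesis
    using depth_carry_block(1)[of n] depth_carry_block(2)[of "n - 1"] by simp
qed

text \<open>Both ladders use the same wires \<open>y\<close>, so the touches of one wire add up;
  reversal keeps their number.\<close>

lemma depth_adder_ge:
  assumes "2 ^ Suc s \<le> n - 1"
  shows "4 * s \<le> toffoli_depth (adder n q)"
proof -
  let ?P = "\<lambda>g. is_Toffoli g \<and> y (2 ^ s - 1) \<in> set (wires g)"
  have "2 * s \<le> length (filter ?P (ladder m y q))" if "2 ^ Suc s \<le> m" "m \<le> n" for m
  proof -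
    have "filter ?P (ladder m y q) = filter (\<lambda>g. y (2 ^ s - 1) \<in> set (wires g)) (ladder m y q)"
      using ladder_Toffoli[OF that(2)] by (intro filter_cong) auto
    then show ?thesis using ladder_touch[OF that(1)] by simp
  qed
  from this[of n] this[of "n - 1"] assms
  have "4 * s \<le> length (filter ?P (ladder n y q)) + length (filter ?P (ladder (n - 1) y q))"
    by linarith
  also have "\<dots> \<le> length (filter ?P (adder n q))"
    using assms by (auto simp: adder_def carry_block_def rev_filter[symmetric])
  also have "\<dots> \<le> toffoli_depth (adder n q)"
    by (rule toffoli_depth_ge)
  finally show ?thesis .
qed

end

section \<open>Asymptotics\<close>

lemma floor_log_bounds:
  assumes "n > 0"
  shows "\<lfloor>log 2 (real n)\<rfloor> = int (floor_log n)"
    and "real (floor_log n) \<le> log 2 (real n)" "log 2 (real n) < real (floor_log n) + 1"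
proof -
  have "0 \<le> \<lfloor>log 2 (real n)\<rfloor>"
    using assms by simp
  then show eq: "\<lfloor>log 2 (real n)\<rfloor> = int (floor_log n)"
    using assms by (simp add: floor_log_altdef)
  show "real (floor_log n) \<le> log 2 (real n)" "log 2 (real n) < real (floor_log n) + 1"
    using eq by linarith+
qed

theorem theorem1:
  "\<exists>C :: nat \<Rightarrow> gate list.
     (\<forall>n\<ge>1. \<exists>k. int k = int n - int (hamming_weight n) - \<lfloor>log 2 (real n)\<rfloor> \<and>
        implements_add n k (C n)) \<and>
     (\<forall>\<^sub>F n in sequentially. 8 * real n - real (toffoli_count (C n)) \<ge> 0) \<and>
     (\<lambda>n. 8 * real n - real (toffoli_count (C n))) \<in> \<Theta>(\<lambda>n. log 2 (real n)) \<and>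
     (\<lambda>n. real (toffoli_depth (C n)) - 4 * log 2 (real n)) \<in> O(\<lambda>n. 1)"
proof -
  \<comment> \<open>One ancilla for each product above level 0.\<close>
  have "\<exists>e. bij_betw e (slots (n div 2)) {..<card (slots (n div 2))}" for n
    using ex_bij_betw_finite_nat[OF finite_slots] by (simp add: atLeast0LessThan)
  then obtain e where e: "bij_betw (e n) (slots (n div 2)) {..<card (slots (n div 2))}" for n
    by metis
  define C where "C n = adder n (multiplier_wire n (e n))" for n
  have lay: "adder_layout n (card (slots (n div 2))) (e n)" if "n \<ge> 1" for n
    using that e by unfold_locales
  have small: "\<exists>k. int k = int n - int (hamming_weight n) - \<lfloor>log 2 (real n)\<rfloor> \<and> implements_add n k (C n)"
    if "n \<ge> 1" for n
  proof (intro exI conjI)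
    show "int (card (slots (n div 2))) = int n - int (hamming_weight n) - \<lfloor>log 2 (real n)\<rfloor>"
      using card_slots_half[of n] floor_log_bounds(1)[of n] that by simp
    show "implements_add n (card (slots (n div 2))) (C n)"
      unfolding C_def by (rule adder_layout.adder_implements[OF lay[OF that]])
  qed
  \<comment> \<open>With \<open>x\<close> the logarithm and \<open>l\<close> its floor, the
    difference is at least \<open>4 + 3 * l > x\<close> and at most
    \<open>4 + 3 * (4 * l + 2) = 12 * l + 10\<close>, hence at most \<open>22 * x\<close> as
    \<open>x\<close> \<ge> 1.\<close>
  have count: "log 2 (real n) \<le> 8 * real n - real (toffoli_count (C n)) \<and>
      8 * real n - real (toffoli_count (C n)) \<le> 22 * log 2 (real n)" if n: "n \<ge> 2" for n
  proof -
    have l1: "1 \<le> log 2 (real n)"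
      using n by simp
    let ?w = "hamming_weight n" and ?w' = "hamming_weight (n - 1)"
    let ?l = "floor_log n" and ?l' = "floor_log (n - 1)"
    have "toffoli_count (C n) + 4 + 3 * (?w + ?l + ?w' + ?l') = 8 * n"
      unfolding C_def using adder_layout.count_adder[OF lay] n by simp
    then have "real (toffoli_count (C n) + 4 + 3 * (?w + ?l + ?w' + ?l')) = real (8 * n)"
      by (rule arg_cong)
    then have eq: "8 * real n - real (toffoli_count (C n)) = 4 + 3 * (real ?w + real ?l + real ?w' + real ?l')"
      by simp
    have "?w \<le> ?l + 1" "?w' \<le> ?l' + 1" "?l' \<le> ?l"
      using hamming_weight_bounds[of n] hamming_weight_bounds[of "n - 1"] floor_log_le_iff[of "n - 1" n] n
      by auto
    then have "real ?w \<le> real ?l + 1" "real ?w' \<le> real ?l' + 1" "real ?l' \<le> real ?l"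
      by linarith+
    moreover have "real ?l \<le> log 2 (real n)" "log 2 (real n) < real ?l + 1"
      using floor_log_bounds(2,3)[of n] n by simp_all
    moreover have "x \<le> 4 + 3 * (w + l + w' + l') \<and> 4 + 3 * (w + l + w' + l') \<le> 22 * x"
      if "w \<le> l + 1" "w' \<le> l' + 1" "l' \<le> l" "l \<le> x" "x < l + 1" "1 \<le> x" "0 \<le> w" "0 \<le> l" "0 \<le> w'" "0 \<le> l'"
      for x w w' l l' :: real
      using that by simp
    ultimately show ?thesis
      using l1 unfolding eq by simp
  qed
  \<comment> \<open>The depth lies between \<open>4 * l - 8\<close> and \<open>4 * l + 6\<close>,
    where \<open>l\<close> is the floor of the logarithm; rounding costs less than 4 more on the
    lower side, whence 12.\<close>
  have depth: "\<bar>real (toffoli_depth (C n)) - 4 * log 2 (real n)\<bar> \<le> 12" if n: "n \<ge> 3" for n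
  proof -
    have "toffoli_depth (C n) \<le> 4 * floor_log n + 6"
      unfolding C_def using adder_layout.depth_adder_le[OF lay] n by simp
    then have up: "real (toffoli_depth (C n)) \<le> 4 * real (floor_log n) + 6"
      by linarith
    have "n div 2 \<le> n - 1" by simp
    then have l: "floor_log n \<le> floor_log (n - 1) + 1"
      using floor_log_le_iff[of "n div 2" "n - 1"] by simp
    have "2 \<le> n - 1" using n by simp
    from floor_log_rec[OF this] have "1 \<le> floor_log (n - 1)" by linarith
    \<comment> \<open>This is the largest \<open>s\<close> that \<open>depth_adder_ge\<close>
      admits.\<close>
    then have "2 ^ Suc (floor_log (n - 1) - 1) \<le> n - 1"
      using floor_log_exp2_le[of "n - 1"] n by simp
    then have "4 * (floor_log (n - 1) - 1) \<le> toffoli_depth (C n)"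
      unfolding C_def using adder_layout.depth_adder_ge[OF lay] n by simp
    then have "4 * real (floor_log n) \<le> real (toffoli_depth (C n)) + 8"
      using l by linarith
    then show ?thesis
      using up floor_log_bounds(2,3)[of n] n by (simp add: abs_le_iff)
  qed
  have large: "\<forall>\<^sub>F n in sequentially. 8 * real n - real (toffoli_count (C n)) \<ge> 0"
    using eventually_ge_at_top[of 2]
  proof eventually_elim
    case (elim n)
    have "0 \<le> log 2 (real n)" using elim by simp
    then show ?case using count[OF elim] by linarith
  qed
  have theta: "(\<lambda>n. 8 * real n - real (toffoli_count (C n))) \<in> \<Theta>(\<lambda>n. log 2 (real n))"
  proof (rule bigthetaI'[of 1 22])
    show "\<forall>\<^sub>F n in sequentially. 1 * norm (log 2 (real n)) \<le> norm (8 * real n - real (toffoli_count (C n))) \<and>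
        norm (8 * real n - real (toffoli_count (C n))) \<le> 22 * norm (log 2 (real n))"
      using eventually_ge_at_top[of 2]
    proof eventually_elim
      case (elim n)
      have "0 \<le> log 2 (real n)" using elim by simp
      then show ?case using count[OF elim] by simp
    qed
  qed simp_all
  have "(\<lambda>n. real (toffoli_depth (C n)) - 4 * log 2 (real n)) \<in> O(\<lambda>n. 1)"
    by (rule bigoI[of _ 12]) (use depth in \<open>auto intro: eventually_mono[OF eventually_ge_at_top[of 3]]\<close>)
  with small large theta show ?thesis
    by blast
qed

end
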